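(* There is a universal constant $c>0$ such that the following holds. Let $n,k\ge1$ be integers, let $g_k$ be a (possibly partial) Boolean function with $\mathrm{dom}(g_k)\subseteq\{0,1\}^k\times\{0,1\}^k$, and let $f_n:\{0,1\}^n\to\{0,1\}$. If $$\rho(g_k)\le \frac{\widetilde{\mathrm{deg}}(f_n)}{2en},$$ then $Q(f_n\Box g_k)\ge c\,\widetilde{\mathrm{deg}}(f_n)$, i.e. $Q(f_n\Box g_k)=\Omega(\widetilde{\mathrm{deg}}(f_n))$.
   Context: Here $e$ is the base of the natural logarithm. Approximate degree: $\widetilde{\mathrm{deg}}(f_n)$ is the smallest degree of a real polynomial $\tilde f:\mathbb{R}^n\to\mathbb{R}$ with $|f_n(x)-\tilde f(x)|\le 1/3$ for all $x\in\{0,1\}^n$. Quantum communication complexity: for a (possibly partial) Boolean function $F$ with $\mathrm{dom}(F)\subseteq X\times Y$, Alice receives $x$, Bob receives $y$, $(x,y)\in\mathrm{dom}(F)$. $Q(F)$ is the minimum worst-case number of qubits exchanged by a two-way interactive quantum protocol (with unlimited prior shared entanglement) that computes $F(x,y)$ with error probability at most $1/3$ on every $(x,y)\in\mathrm{dom}(F)$. Block composition: $f_n\Box g_k$ is the (partial) function on $(x,y)\in\{0,1\}^{nk}\times\{0,1\}^{nk}$, with $x=x_1\cdots x_n$, $y=y_1\cdots y_n$, $x_i,y_i\in\{0,1\}^k$, given by $f_n\Box g_k(x,y)=f_n(g_k(x_1,y_1),\ldots,g_k(x_n,y_n))$, defined when all $(x_i,y_i)\in\mathrm{dom}(g_k)$.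 Spectral discrepancy: for $I_A,I_B\subseteq\{0,1\}^k$ and $b\in\{0,1\}$, a $b$-distribution is a probability distribution $\mu_b$ on $g_k^{-1}(b)\cap(I_A\times I_B)$, viewed as a matrix in $\mathbb{R}^{I_A\times I_B}$ (zero outside the support). The spectral discrepancy $\rho(g_k)$ is the minimum $r\in\mathbb{R}$ such that there exist $I_A,I_B\subseteq\{0,1\}^k$ and $b$-distributions $\mu_b\in\mathbb{R}^{I_A\times I_B}$ for $g_k$, $b\in\{0,1\}$, with (1) $\sqrt{|I_A|\cdot|I_B|}\cdot\left\|\frac{\mu_0+\mu_1}{2}\right\|\le 1+r$ and (2) $\sqrt{|I_A|\cdot|I_B|}\cdot\left\|\frac{\mu_0-\mu_1}{2}\right\|\le r$, where $\|\cdot\|$ is the operator (spectral) norm. If $g_k$ does not take both values, set $\rho(g_k)=+\infty$. *)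

theory Defs
  imports "HOL-Probability.Probability" "HOL-Library.Poly_Mapping"
begin

section \<open>Bit strings and block composition\<close>

text \<open>A bit string is a \<^typ>\<open>bool list\<close>. A total function on \<open>{0,1}\<^sup>n\<close> is given by its values on
  \<open>bits n\<close> (its values on lists of other lengths are never used); a partial Boolean function of two
  inputs is a map, so that \<^const>\<open>dom\<close> is its domain.\<close>

definition bits :: "nat \<Rightarrow> bool list set" where
  "bits n = {xs. length xs = n}"

definition block :: "nat \<Rightarrow> 'a list \<Rightarrow> nat \<Rightarrow> 'a list" where
  "block k xs i = take k (drop (i * k) xs)"

definition block_compose ::
  "nat \<Rightarrow> nat \<Rightarrow> (bool list \<Rightarrow> bool) \<Rightarrow> (bool list \<times> bool list \<rightharpoonup> bool)
    \<Rightarrow> (bool list \<times> bool list \<rightharpoonup> bool)" where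
  "block_compose n k f g = (\<lambda>(x, y).
     if x \<in> bits (n * k) \<and> y \<in> bits (n * k) \<and> (\<forall>i<n. (block k x i, block k y i) \<in> dom g)
     then Some (f (map (\<lambda>i. the (g (block k x i, block k y i))) [0..<n]))
     else None)"


section \<open>Approximate degree\<close>

text \<open>A real polynomial in the variables \<open>X\<^sub>0, X\<^sub>1, \<dots>\<close> maps monomials (exponent vectors of finite
  support) to coefficients. The zero polynomial is given degree 0.\<close>

type_synonym real_mpoly = "(nat \<Rightarrow>\<^sub>0 nat) \<Rightarrow>\<^sub>0 real"

definition in_variables :: "nat \<Rightarrow> real_mpoly \<Rightarrow> bool" where
  "in_variables n p \<longleftrightarrow> (\<forall>m\<in>Poly_Mapping.keys p. Poly_Mapping.keys m \<subseteq> {..<n})"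

definition mpoly_eval :: "real_mpoly \<Rightarrow> (nat \<Rightarrow> real) \<Rightarrow> real" where
  "mpoly_eval p v = (\<Sum>m\<in>Poly_Mapping.keys p.
     Poly_Mapping.lookup p m * (\<Prod>i\<in>Poly_Mapping.keys m. v i ^ Poly_Mapping.lookup m i))"

definition total_degree :: "real_mpoly \<Rightarrow> nat" where
  "total_degree p = Max (insert 0
     ((\<lambda>m. \<Sum>i\<in>Poly_Mapping.keys m. Poly_Mapping.lookup m i) ` Poly_Mapping.keys p))"

definition approx_degree :: "nat \<Rightarrow> (bool list \<Rightarrow> bool) \<Rightarrow> nat" where
  "approx_degree n f = (LEAST d. \<exists>p. in_variables n p \<and> total_degree p = d \<and>
     (\<forall>x\<in>bits n. \<bar>of_bool (f x) - mpoly_eval p (\<lambda>i. of_bool (x ! i))\<bar> \<le> 1 / 3))"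


section \<open>Spectral discrepancy\<close>

text \<open>The operator norm, with respect to the Euclidean norms, of the real matrix \<open>M\<close> with rows
  indexed by the finite set \<open>A\<close> and columns by the finite set \<open>B\<close>.\<close>

definition spectral_norm :: "'a set \<Rightarrow> 'b set \<Rightarrow> ('a \<Rightarrow> 'b \<Rightarrow> real) \<Rightarrow> real" where
  "spectral_norm A B M = Sup {L2_set (\<lambda>a. \<Sum>b\<in>B. M a b * v b) A | v. L2_set v B \<le> 1}"

definition is_b_distribution ::
  "(bool list \<times> bool list \<rightharpoonup> bool) \<Rightarrow> bool list set \<Rightarrow> bool list set \<Rightarrow> bool
    \<Rightarrow> (bool list \<times> bool list) pmf \<Rightarrow> bool" where
  "is_b_distribution g I\<^sub>A I\<^sub>B b \<mu> \<longleftrightarrow> set_pmf \<mu> \<subseteq> g -` {Some b} \<inter> I\<^sub>A \<times> I\<^sub>B"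

definition spectral_discrepancy_witness ::
  "nat \<Rightarrow> (bool list \<times> bool list \<rightharpoonup> bool) \<Rightarrow> real \<Rightarrow> bool" where
  "spectral_discrepancy_witness k g r \<longleftrightarrow>
     (\<exists>I\<^sub>A I\<^sub>B \<mu>\<^sub>0 \<mu>\<^sub>1. I\<^sub>A \<subseteq> bits k \<and> I\<^sub>B \<subseteq> bits k \<and>
        is_b_distribution g I\<^sub>A I\<^sub>B False \<mu>\<^sub>0 \<and> is_b_distribution g I\<^sub>A I\<^sub>B True \<mu>\<^sub>1 \<and>
        sqrt (real (card I\<^sub>A) * real (card I\<^sub>B)) *
          spectral_norm I\<^sub>A I\<^sub>B (\<lambda>a b. (pmf \<mu>\<^sub>0 (a, b) + pmf \<mu>\<^sub>1 (a, b)) / 2) \<le> 1 + r \<and>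
        sqrt (real (card I\<^sub>A) * real (card I\<^sub>B)) *
          spectral_norm I\<^sub>A I\<^sub>B (\<lambda>a b. (pmf \<mu>\<^sub>0 (a, b) - pmf \<mu>\<^sub>1 (a, b)) / 2) \<le> r)"

text \<open>By compactness of the set of distributions the infimum is attained when it is finite. If
  \<open>g\<close> does not take both values, one of the two kinds of distributions does not exist, and the
  infimum of the empty set is \<open>\<infinity>\<close>.\<close>

definition spectral_discrepancy ::
  "nat \<Rightarrow> (bool list \<times> bool list \<rightharpoonup> bool) \<Rightarrow> ereal" where
  "spectral_discrepancy k g = Inf (ereal ` {r. spectral_discrepancy_witness k g r})"


section \<open>Quantum communication complexity\<close>

text \<open>The joint system consists of qubits \<open>0, \<dots>, N - 1\<close>. A computational basis state is
  identified with the set \<open>z \<subseteq> {..<N}\<close> of the qubits in state 1, and a state vector assigns an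
  amplitude to every such set. A linear operator on the qubits in \<open>S\<close> is a matrix indexed by the
  subsets of \<open>S\<close>; \<open>apply_local S U\<close> is \<open>U\<close> tensored with the identity on the other qubits.\<close>

type_synonym qstate = "nat set \<Rightarrow> complex"
type_synonym qoperator = "nat set \<Rightarrow> nat set \<Rightarrow> complex"

definition unitary_on :: "nat set \<Rightarrow> qoperator \<Rightarrow> bool" where
  "unitary_on S U \<longleftrightarrow>
     (\<forall>v\<in>Pow S. \<forall>w\<in>Pow S. (\<Sum>u\<in>Pow S. cnj (U u v) * U u w) = of_bool (v = w)) \<and>
     (\<forall>v\<in>Pow S. \<forall>w\<in>Pow S. (\<Sum>u\<in>Pow S. U v u * cnj (U w u)) = of_bool (v = w))"

definition apply_local :: "nat set \<Rightarrow> qoperator \<Rightarrow> qstate \<Rightarrow> qstate" where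
  "apply_local S U \<psi> = (\<lambda>z. \<Sum>w\<in>Pow S. U (z \<inter> S) w * \<psi> (w \<union> (z - S)))"

text \<open>In an action a player applies a unitary, which depends on the player's own input only, to all
  the qubits the player holds, and then selects one of these qubits. Used as a message, the
  selected qubit is handed over to the other player; used as the final action, it is measured
  in the computational basis and the outcome is the output of the protocol. Messages of several
  qubits are consecutive actions of the same player.\<close>

datatype ('x, 'y) action =
    Alice "'x \<Rightarrow> qoperator" nat
  | Bob "'y \<Rightarrow> qoperator" nat

primrec selected_qubit :: "('x, 'y) action \<Rightarrow> nat" where
  "selected_qubit (Alice U q) = q"
| "selected_qubit (Bob U q) = q"

text \<open>The argument \<open>A\<close> is the set of qubits held by Alice before the action; Bob holds
  \<open>{..<N} - A\<close>.\<close>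

primrec valid_action :: "nat \<Rightarrow> nat set \<Rightarrow> ('x, 'y) action \<Rightarrow> bool" where
  "valid_action N A (Alice U q) \<longleftrightarrow> q \<in> A \<and> (\<forall>x. unitary_on A (U x))"
| "valid_action N A (Bob U q) \<longleftrightarrow> q \<in> {..<N} - A \<and> (\<forall>y. unitary_on ({..<N} - A) (U y))"

primrec transfer_qubit :: "('x, 'y) action \<Rightarrow> nat set \<Rightarrow> nat set" where
  "transfer_qubit (Alice U q) A = A - {q}"
| "transfer_qubit (Bob U q) A = insert q A"

primrec action_unitary ::
  "nat \<Rightarrow> 'x \<Rightarrow> 'y \<Rightarrow> nat set \<Rightarrow> ('x, 'y) action \<Rightarrow> qstate \<Rightarrow> qstate" where
  "action_unitary N x y A (Alice U q) \<psi> = apply_local A (U x) \<psi>"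
| "action_unitary N x y A (Bob U q) \<psi> = apply_local ({..<N} - A) (U y) \<psi>"

primrec valid_actions :: "nat \<Rightarrow> nat set \<Rightarrow> ('x, 'y) action list \<Rightarrow> bool" where
  "valid_actions N A [] \<longleftrightarrow> True"
| "valid_actions N A (a # as) \<longleftrightarrow>
     valid_action N A a \<and> valid_actions N (transfer_qubit a A) as"

primrec run_actions ::
  "nat \<Rightarrow> 'x \<Rightarrow> 'y \<Rightarrow> nat set \<Rightarrow> ('x, 'y) action list \<Rightarrow> qstate \<Rightarrow> qstate" where
  "run_actions N x y A [] \<psi> = \<psi>"
| "run_actions N x y A (a # as) \<psi> =
     run_actions N x y (transfer_qubit a A) as (action_unitary N x y A a \<psi>)"

text \<open>The initial state is an arbitrary unit vector independent of the inputs, shared between the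
  players in an arbitrary way: it provides both the prior entanglement and the private ancillas.\<close>

record ('x, 'y) qprotocol =
  num_qubits :: nat
  alice_qubits :: "nat set"
  initial_state :: qstate
  messages :: "('x, 'y) action list"
  final_action :: "('x, 'y) action"

definition valid_qprotocol :: "('x, 'y) qprotocol \<Rightarrow> bool" where
  "valid_qprotocol P \<longleftrightarrow>
     alice_qubits P \<subseteq> {..<num_qubits P} \<and>
     (\<Sum>z\<in>Pow {..<num_qubits P}. (cmod (initial_state P z))\<^sup>2) = 1 \<and>
     valid_actions (num_qubits P) (alice_qubits P) (messages P @ [final_action P])"

definition output_prob :: "('x, 'y) qprotocol \<Rightarrow> 'x \<Rightarrow> 'y \<Rightarrow> bool \<Rightarrow> real" where
  "output_prob P x y b =
     (\<Sum>z \<in> {z \<in> Pow {..<num_qubits P}. (selected_qubit (final_action P) \<in> z) = b}.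
        (cmod (run_actions (num_qubits P) x y (alice_qubits P)
                 (messages P @ [final_action P]) (initial_state P) z))\<^sup>2)"

definition computes :: "('x, 'y) qprotocol \<Rightarrow> ('x \<times> 'y \<rightharpoonup> bool) \<Rightarrow> bool" where
  "computes P F \<longleftrightarrow> (\<forall>x y b. F (x, y) = Some b \<longrightarrow> output_prob P x y (\<not> b) \<le> 1 / 3)"

text \<open>Number of qubits exchanged, \<open>\<infinity>\<close> if no protocol computes \<open>F\<close>.\<close>

definition quantum_cc :: "('x \<times> 'y \<rightharpoonup> bool) \<Rightarrow> enat" where
  "quantum_cc F = Inf {enat (length (messages P)) | P. valid_qprotocol P \<and> computes P F}"

end

(*
  The argument is primal and uses no linear programming duality. Let p(x,y) be the acceptance
  probability of a protocol exchanging q qubits. In the Heisenberg picture p is a sum of 4^q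
  expressions <psi, S(x) T(y) psi> with contractions S(x) of Alice and T(y) of Bob, so its Schur
  multiplier norm is at most 2 * 4^q, and that of Q = 3p^2 - 2p^3 at most 28 * 64^q.

  For z in {0,1}^n average Q over blocks (x_i,y_i) drawn independently from mu_{z_i}. The average
  E(z) is within 7/27 of f(z). Writing mu_b = D_+ + (-1)^b D_- with D_+ = (mu_0 + mu_1)/2 and
  D_- = (mu_0 - mu_1)/2 and expanding the product gives the Fourier expansion of E, in which the
  coefficient of the character of S is at most 28 * 64^q * r^|S| * (1+r)^(n-|S|). The part of E of
  degree at least d = deg(f) is thus at most 28 * 64^q * (1+5r)^n / 4^d <= 28 * 64^q * (3/4)^d. As
  it cannot be dropped without raising the error above 1/3, q is linear in d once q >= 1. For q = 0
  the output depends on one input only, which forces f to be constant.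
*)
theory Submission
  imports Defs
begin

section \<open>Bilinear bounds and Schur multipliers\<close>

text \<open>A protocol may err by exactly 1/3, which is also the tolerance in the approximate
  degree, so \<open>p\<close> itself leaves no slack for a discarded tail. The majority polynomial
  lowers the error to 7/27 and buys 2/27. It is applied to probabilities, not to protocols, which is
  why a norm that respects entrywise products is wanted. The factor
  \<open>sqrt (card I * card J)\<close> in the spectral discrepancy is what makes averages
  computable: an average tests a matrix on all-ones vectors, and over \<open>n\<close> blocks their
  norms contribute exactly the \<open>n\<close>-th power of that factor. The base 4 of the tail
  bound is tuned to the constant \<open>2 * e\<close>: weighting a frequency set \<open>S\<close> by
  \<open>4 ^ card S\<close> produces \<open>1 + 5 * r\<close> with 5 = 4 + 1, and
  \<open>5 < 2 * e\<close>. For positive degree \<open>d\<close> the hypothesis therefore yields a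
  witness with \<open>5 * r * n < d\<close>, so attainment of the infimum is never at issue, and
  \<open>e < 3 < 4\<close> gives the decay. Constant factors in the Schur bound are absorbed by
  powers of 64 only when some qubit is sent; hence the separate case of silent protocols.\<close>

definition op_bounded :: "'a set \<Rightarrow> 'b set \<Rightarrow> ('a \<Rightarrow> 'b \<Rightarrow> real) \<Rightarrow> real \<Rightarrow> bool" where
  "op_bounded X Y M c \<longleftrightarrow> 0 \<le> c \<and>
     (\<forall>u v. \<bar>\<Sum>x\<in>X. \<Sum>y\<in>Y. u x * M x y * v y\<bar> \<le> c * (L2_set u X * L2_set v Y))"

text \<open>Schur (Hadamard) multiplier norms are used in place of factorization norms: they are
  submultiplicative under the entrywise product without any tensor construction.\<close>
definition schur_bounded :: "'a set \<Rightarrow> 'b set \<Rightarrow> ('a \<Rightarrow> 'b \<Rightarrow> real) \<Rightarrow> real \<Rightarrow> bool" where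
  "schur_bounded X Y P K \<longleftrightarrow> 0 \<le> K \<and>
     (\<forall>M c. op_bounded X Y M c \<longrightarrow> op_bounded X Y (\<lambda>x y. M x y * P x y) (K * c))"

lemma op_bounded_le:
  "op_bounded X Y M c \<Longrightarrow> \<bar>\<Sum>x\<in>X. \<Sum>y\<in>Y. u x * M x y * v y\<bar> \<le> c * (L2_set u X * L2_set v Y)"
  by (simp add: op_bounded_def)

lemma op_bounded_add:
  assumes "op_bounded X Y M c" "op_bounded X Y M' c'"
  shows "op_bounded X Y (\<lambda>x y. M x y + M' x y) (c + c')"
  unfolding op_bounded_def
proof (intro conjI allI)
  show "0 \<le> c + c'" using assms by (simp add: op_bounded_def)
next
  fix u v
  have "(\<Sum>x\<in>X. \<Sum>y\<in>Y. u x * (M x y + M' x y) * v y)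
      = (\<Sum>x\<in>X. \<Sum>y\<in>Y. u x * M x y * v y) + (\<Sum>x\<in>X. \<Sum>y\<in>Y. u x * M' x y * v y)"
    by (simp add: algebra_simps sum.distrib)
  also have "\<bar>\<dots>\<bar> \<le> c * (L2_set u X * L2_set v Y) + c' * (L2_set u X * L2_set v Y)"
    using assms unfolding op_bounded_def by (intro order_trans[OF abs_triangle_ineq] add_mono) auto
  finally show "\<bar>\<Sum>x\<in>X. \<Sum>y\<in>Y. u x * (M x y + M' x y) * v y\<bar> \<le> (c + c') * (L2_set u X * L2_set v Y)"
    by (simp add: algebra_simps)
qed

lemma op_bounded_cmult:
  assumes "op_bounded X Y M c"
  shows "op_bounded X Y (\<lambda>x y. t * M x y) (\<bar>t\<bar> * c)"
  unfolding op_bounded_def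
proof (intro conjI allI)
  show "0 \<le> \<bar>t\<bar> * c" using assms by (simp add: op_bounded_def)
next
  fix u v
  have "(\<Sum>x\<in>X. \<Sum>y\<in>Y. u x * (t * M x y) * v y) = t * (\<Sum>x\<in>X. \<Sum>y\<in>Y. u x * M x y * v y)"
    by (simp add: sum_distrib_left mult_ac)
  then show "\<bar>\<Sum>x\<in>X. \<Sum>y\<in>Y. u x * (t * M x y) * v y\<bar> \<le> \<bar>t\<bar> * c * (L2_set u X * L2_set v Y)"
    using assms unfolding op_bounded_def by (simp add: abs_mult mult.assoc mult_left_mono)
qed

lemma op_bounded_mono:
  assumes "op_bounded X Y M c" "c \<le> c'"
  shows "op_bounded X Y M c'"
  unfolding op_bounded_def
proof (intro conjI allI)
  show "0 \<le> c'" using assms by (simp add: op_bounded_def)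
next
  fix u v
  have "\<bar>\<Sum>x\<in>X. \<Sum>y\<in>Y. u x * M x y * v y\<bar> \<le> c * (L2_set u X * L2_set v Y)"
    using assms(1) unfolding op_bounded_def by blast
  also have "\<dots> \<le> c' * (L2_set u X * L2_set v Y)"
    using assms(2) by (intro mult_right_mono) auto
  finally show "\<bar>\<Sum>x\<in>X. \<Sum>y\<in>Y. u x * M x y * v y\<bar> \<le> c' * (L2_set u X * L2_set v Y)" .
qed

lemma schur_bounded_add:
  assumes "schur_bounded X Y P K" "schur_bounded X Y P' K'"
  shows "schur_bounded X Y (\<lambda>x y. P x y + P' x y) (K + K')"
  unfolding schur_bounded_def
proof (intro conjI allI impI)
  show "0 \<le> K + K'" using assms by (simp add: schur_bounded_def)
next
  fix M c assume "op_bounded X Y M c"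
  then have "op_bounded X Y (\<lambda>x y. M x y * P x y) (K * c)"
    and "op_bounded X Y (\<lambda>x y. M x y * P' x y) (K' * c)"
    using assms by (simp_all add: schur_bounded_def)
  from op_bounded_add[OF this]
  show "op_bounded X Y (\<lambda>x y. M x y * (P x y + P' x y)) ((K + K') * c)"
    by (simp add: algebra_simps)
qed

lemma schur_bounded_cmult:
  assumes "schur_bounded X Y P K"
  shows "schur_bounded X Y (\<lambda>x y. t * P x y) (\<bar>t\<bar> * K)"
  unfolding schur_bounded_def
proof (intro conjI allI impI)
  show "0 \<le> \<bar>t\<bar> * K" using assms by (simp add: schur_bounded_def)
next
  fix M c assume "op_bounded X Y M c"
  then have "op_bounded X Y (\<lambda>x y. M x y * P x y) (K * c)"
    using assms by (simp add: schur_bounded_def)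
  from op_bounded_cmult[OF this, of t]
  show "op_bounded X Y (\<lambda>x y. M x y * (t * P x y)) (\<bar>t\<bar> * K * c)"
    by (simp add: mult_ac)
qed

text \<open>Multiplying by the product means multiplying by one factor after the other, so bounds
  compose. This is how powers of an acceptance probability are handled.\<close>

lemma schur_bounded_mult:
  assumes "schur_bounded X Y P K" "schur_bounded X Y P' K'"
  shows "schur_bounded X Y (\<lambda>x y. P x y * P' x y) (K * K')"
  unfolding schur_bounded_def
proof (intro conjI allI impI)
  show "0 \<le> K * K'" using assms by (simp add: schur_bounded_def)
next
  fix M c assume "op_bounded X Y M c"
  then have "op_bounded X Y (\<lambda>x y. M x y * P x y * P' x y) (K' * (K * c))"
    using assms by (simp add: schur_bounded_def)
  then show "op_bounded X Y (\<lambda>x y. M x y * (P x y * P' x y)) (K * K' * c)"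
    by (simp add: mult_ac)
qed

lemma schur_bounded_mono:
  assumes "schur_bounded X Y P K" "K \<le> K'"
  shows "schur_bounded X Y P K'"
  unfolding schur_bounded_def
proof (intro conjI allI impI)
  show "0 \<le> K'" using assms by (simp add: schur_bounded_def)
next
  fix M c assume M: "op_bounded X Y M c"
  then have "op_bounded X Y (\<lambda>x y. M x y * P x y) (K * c)"
    using assms by (simp add: schur_bounded_def)
  then show "op_bounded X Y (\<lambda>x y. M x y * P x y) (K' * c)"
    using assms(2) M by (rule_tac op_bounded_mono) (auto simp: op_bounded_def mult_right_mono)
qed

text \<open>The easy direction of the factorization theorem for Schur multipliers. Each coordinate
  \<open>i\<close> only rescales the test vectors \<open>u\<close> and \<open>v\<close>, and
  Cauchy-Schwarz over \<open>i\<close> puts the rescaled pieces together.\<close>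

lemma schur_bounded_inner:
  fixes \<alpha> :: "'x \<Rightarrow> 'i \<Rightarrow> real" and \<beta> :: "'y \<Rightarrow> 'i \<Rightarrow> real"
  assumes \<alpha>: "\<And>x. x \<in> X \<Longrightarrow> (\<Sum>i\<in>I. (\<alpha> x i)\<^sup>2) \<le> 1"
    and \<beta>: "\<And>y. y \<in> Y \<Longrightarrow> (\<Sum>i\<in>I. (\<beta> y i)\<^sup>2) \<le> 1"
  shows "schur_bounded X Y (\<lambda>x y. \<Sum>i\<in>I. \<alpha> x i * \<beta> y i) 1"
  unfolding schur_bounded_def
proof (intro conjI allI impI)
  fix M c assume M: "op_bounded X Y M c"
  \<comment> \<open>Over all \<open>i\<close> the pieces \<open>w x * \<gamma> x i\<close> carry no
    more square mass than \<open>w\<close>.\<close>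
  have weighted: "L2_set (\<lambda>i. L2_set (\<lambda>x. w x * \<gamma> x i) Z) I \<le> L2_set w Z"
    if "\<And>x. x \<in> Z \<Longrightarrow> (\<Sum>i\<in>I. (\<gamma> x i)\<^sup>2) \<le> 1" for w and \<gamma> :: "'z \<Rightarrow> 'i \<Rightarrow> real" and Z
  proof -
    have "(\<Sum>i\<in>I. \<Sum>x\<in>Z. (w x * \<gamma> x i)\<^sup>2) = (\<Sum>x\<in>Z. (w x)\<^sup>2 * (\<Sum>i\<in>I. (\<gamma> x i)\<^sup>2))"
      by (subst sum.swap) (simp add: power_mult_distrib sum_distrib_left)
    also have "\<dots> \<le> (\<Sum>x\<in>Z. (w x)\<^sup>2)"
      using that by (intro sum_mono) (simp add: mult_left_le)
    finally show ?thesis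
      by (simp add: L2_set_def sum_nonneg)
  qed
  show "op_bounded X Y (\<lambda>x y. M x y * (\<Sum>i\<in>I. \<alpha> x i * \<beta> y i)) (1 * c)"
    unfolding op_bounded_def
  proof (intro conjI allI)
    show "0 \<le> 1 * c" using M by (simp add: op_bounded_def)
  next
    fix u v
    have "(\<Sum>x\<in>X. \<Sum>y\<in>Y. u x * (M x y * (\<Sum>i\<in>I. \<alpha> x i * \<beta> y i)) * v y)
        = (\<Sum>x\<in>X. \<Sum>y\<in>Y. \<Sum>i\<in>I. (u x * \<alpha> x i) * M x y * (v y * \<beta> y i))"
      by (simp add: sum_distrib_left sum_distrib_right mult_ac)
    also have "\<dots> = (\<Sum>x\<in>X. \<Sum>i\<in>I. \<Sum>y\<in>Y. (u x * \<alpha> x i) * M x y * (v y * \<beta> y i))"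
      by (intro sum.cong refl sum.swap)
    also have "\<dots> = (\<Sum>i\<in>I. \<Sum>x\<in>X. \<Sum>y\<in>Y. (u x * \<alpha> x i) * M x y * (v y * \<beta> y i))"
      by (rule sum.swap)
    also have "\<bar>\<dots>\<bar> \<le> (\<Sum>i\<in>I. c * (L2_set (\<lambda>x. u x * \<alpha> x i) X * L2_set (\<lambda>y. v y * \<beta> y i) Y))"
      using M by (intro order_trans[OF sum_abs[where A = I]] sum_mono op_bounded_le)
    also have "\<dots> = c * (\<Sum>i\<in>I. \<bar>L2_set (\<lambda>x. u x * \<alpha> x i) X\<bar> * \<bar>L2_set (\<lambda>y. v y * \<beta> y i) Y\<bar>)"
      by (simp add: sum_distrib_left)
    also have "\<dots> \<le> c * (L2_set (\<lambda>i. L2_set (\<lambda>x. u x * \<alpha> x i) X) I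
                        * L2_set (\<lambda>i. L2_set (\<lambda>y. v y * \<beta> y i) Y) I)"
      using M by (intro mult_left_mono L2_set_mult_ineq) (auto simp: op_bounded_def)
    also have "\<dots> \<le> c * (L2_set u X * L2_set v Y)"
      using M weighted[OF \<alpha>] weighted[OF \<beta>]
      by (intro mult_left_mono mult_mono) (auto simp: op_bounded_def)
    finally show "\<bar>\<Sum>x\<in>X. \<Sum>y\<in>Y. u x * (M x y * (\<Sum>i\<in>I. \<alpha> x i * \<beta> y i)) * v y\<bar>
        \<le> 1 * c * (L2_set u X * L2_set v Y)"
      by simp
  qed
qed simp

section \<open>Bilinear bounds and the spectral norm\<close>

text \<open>Test the bilinear bound on the image vector itself and cancel one factor of its
  norm.\<close>

lemma op_bounded_L2_set_le:
  assumes "op_bounded X Y M c"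
  shows "L2_set (\<lambda>y. \<Sum>x\<in>X. u x * M x y) Y \<le> c * L2_set u X"
proof -
  define w where "w y = (\<Sum>x\<in>X. u x * M x y)" for y
  have "L2_set w Y * L2_set w Y = (\<Sum>y\<in>Y. w y * w y)"
    by (simp add: L2_set_def sum_nonneg power2_eq_square)
  also have "\<dots> = (\<Sum>y\<in>Y. \<Sum>x\<in>X. u x * M x y * w y)"
    by (simp add: w_def sum_distrib_right)
  also have "\<dots> = (\<Sum>x\<in>X. \<Sum>y\<in>Y. u x * M x y * w y)"
    by (rule sum.swap)
  also have "\<dots> \<le> c * L2_set u X * L2_set w Y"
    using op_bounded_le[OF assms, of u w] by linarith
  finally have "L2_set w Y * L2_set w Y \<le> c * L2_set u X * L2_set w Y" .
  moreover have "0 \<le> L2_set w Y" "0 \<le> c * L2_set u X"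
    using assms by (auto simp: op_bounded_def)
  ultimately have "L2_set w Y \<le> c * L2_set u X"
    by (cases "L2_set w Y = 0") (auto simp: mult_le_cancel_right)
  then show ?thesis by (simp only: w_def[abs_def])
qed

lemma op_bounded_spectral_norm:
  assumes "finite A" "finite B" "spectral_norm A B M \<le> c"
  shows "op_bounded A B M c"
proof -
  define V where "V = {L2_set (\<lambda>a. \<Sum>b\<in>B. M a b * v b) A | v. L2_set v B \<le> 1}"
  \<comment> \<open>\<open>Sup\<close> over the reals bounds the members of a set only if the set is
    bounded above. The sum of all absolute entries does this, because coordinates of vectors in the
    unit ball are at most 1 in absolute value.\<close>
  have "bdd_above V"
  proof (rule bdd_aboveI)
    fix s assume "s \<in> V"
    then obtain v where s: "s = L2_set (\<lambda>a. \<Sum>b\<in>B. M a b * v b) A" and v: "L2_set v B \<le> 1"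
      by (auto simp: V_def)
    have "s \<le> (\<Sum>a\<in>A. \<bar>\<Sum>b\<in>B. M a b * v b\<bar>)"
      unfolding s by (rule L2_set_le_sum_abs)
    also have "\<dots> \<le> (\<Sum>a\<in>A. \<Sum>b\<in>B. \<bar>M a b\<bar>)"
    proof (intro sum_mono order_trans[OF sum_abs])
      fix a b assume "b \<in> B"
      then have "\<bar>v b\<bar> \<le> L2_set (\<lambda>b. \<bar>v b\<bar>) B"
        by (rule member_le_L2_set[OF assms(2)])
      then have "\<bar>v b\<bar> \<le> 1"
        using v unfolding L2_set_def by (simp del: real_sqrt_le_1_iff)
      then show "\<bar>M a b * v b\<bar> \<le> \<bar>M a b\<bar>"
        by (simp add: abs_mult mult_left_le)
    qed
    finally show "s \<le> (\<Sum>a\<in>A. \<Sum>b\<in>B. \<bar>M a b\<bar>)" .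
  qed
  then have up: "L2_set (\<lambda>a. \<Sum>b\<in>B. M a b * v b) A \<le> c" if "L2_set v B \<le> 1" for v
  proof -
    have "L2_set (\<lambda>a. \<Sum>b\<in>B. M a b * v b) A \<in> V"
      unfolding V_def using that by blast
    from cSup_upper[OF this \<open>bdd_above V\<close>] show ?thesis
      using assms(3) unfolding spectral_norm_def V_def[symmetric] by linarith
  qed
  \<comment> \<open>The zero vector lies in the unit ball, which forces \<open>c\<close> to be
    nonnegative.\<close>
  have c: "0 \<le> c" using up[of "\<lambda>_. 0"] by (simp add: L2_set_def)
  have le: "L2_set (\<lambda>a. \<Sum>b\<in>B. M a b * v b) A \<le> c * L2_set v B" for v
  proof (cases "L2_set v B = 0")
    case True
    then have "\<forall>b\<in>B. v b = 0" using assms(2) by (simp add: L2_set_eq_0_iff)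
    then show ?thesis using True by (simp add: L2_set_def)
  next
    case False
    define l where "l = L2_set v B"
    have l: "l > 0" using False by (simp add: l_def order_less_le)
    have "L2_set (\<lambda>b. (1/l) * v b) B = (1/l) * L2_set v B"
      using l by (intro L2_set_right_distrib[symmetric]) auto
    then have "L2_set (\<lambda>b. (1/l) * v b) B \<le> 1" using l by (simp add: l_def[symmetric])
    from up[OF this] have "L2_set (\<lambda>a. (1/l) * (\<Sum>b\<in>B. M a b * v b)) A \<le> c"
      by (simp add: sum_distrib_left mult_ac)
    then have "(1/l) * L2_set (\<lambda>a. \<Sum>b\<in>B. M a b * v b) A \<le> c"
      using l by (subst L2_set_right_distrib) auto
    then show ?thesis using l by (simp add: l_def[symmetric] field_simps)
  qed
  show ?thesis
    unfolding op_bounded_def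
  proof (intro conjI allI c)
    fix u v
    have "(\<Sum>x\<in>A. \<Sum>y\<in>B. u x * M x y * v y) = (\<Sum>x\<in>A. u x * (\<Sum>y\<in>B. M x y * v y))"
      by (simp add: sum_distrib_left mult.assoc)
    also have "\<bar>\<dots>\<bar> \<le> (\<Sum>x\<in>A. \<bar>u x\<bar> * \<bar>\<Sum>y\<in>B. M x y * v y\<bar>)"
      by (intro order_trans[OF sum_abs]) (simp add: abs_mult)
    also have "\<dots> \<le> L2_set u A * L2_set (\<lambda>x. \<Sum>y\<in>B. M x y * v y) A"
      by (rule L2_set_mult_ineq)
    also have "\<dots> \<le> L2_set u A * (c * L2_set v B)"
      by (intro mult_left_mono le) simp
    finally show "\<bar>\<Sum>x\<in>A. \<Sum>y\<in>B. u x * M x y * v y\<bar> \<le> c * (L2_set u A * L2_set v B)"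
      by (simp add: mult_ac)
  qed
qed

section \<open>Tensor products indexed by blocks\<close>

text \<open>The \<open>n\<close>-fold product of \<open>I\<close>, flattened to concatenated strings
  because the inputs of \<open>block_compose\<close> are single strings of length
  \<open>n * k\<close>.\<close>

definition blocks_in :: "nat \<Rightarrow> nat \<Rightarrow> 'a list set \<Rightarrow> 'a list set" where
  "blocks_in k n I = {x. length x = n * k \<and> (\<forall>i<n. block k x i \<in> I)}"

lemma block_append:
  assumes "length x = n * k" "i < n"
  shows "block k (x @ a) i = block k x i"
proof -
  have "k + i * k \<le> n * k"
    using mult_le_mono1[of "Suc i" n k] assms(2) by simp
  then show ?thesis using assms by (simp add: block_def)
qed

lemma block_append_last:
  assumes "length x = n * k" "length a = k"
  shows "block k (x @ a) n = a"
  using assms by (simp add: block_def)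

text \<open>Appending the last block is a bijection; the inductions on the number of blocks rest on
  it.\<close>

lemma sum_blocks_in_Suc:
  assumes "\<forall>a\<in>I. length a = k"
  shows "(\<Sum>x\<in>blocks_in k (Suc n) I. h x) = (\<Sum>x\<in>blocks_in k n I. \<Sum>a\<in>I. h (x @ a))"
proof -
  have "(\<Sum>x\<in>blocks_in k (Suc n) I. h x) = (\<Sum>(x, a)\<in>blocks_in k n I \<times> I. h (x @ a))"
  proof (rule sum.reindex_bij_witness[of _ "\<lambda>(x, a). x @ a" "\<lambda>x. (take (n * k) x, drop (n * k) x)"])
    fix x assume x: "x \<in> blocks_in k (Suc n) I"
    then have len: "length x = k + n * k" by (simp add: blocks_in_def)
    have "block k (take (n * k) x) i = block k x i" if "i < n" for i
      using block_append[of "take (n * k) x" n k i "drop (n * k) x"] that len by simp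
    moreover have "drop (n * k) x = block k x n"
      using len by (simp add: block_def)
    ultimately show "(take (n * k) x, drop (n * k) x) \<in> blocks_in k n I \<times> I"
      using x len by (auto simp: blocks_in_def)
  next
    fix p assume "p \<in> blocks_in k n I \<times> I"
    then show "(case p of (x, a) \<Rightarrow> x @ a) \<in> blocks_in k (Suc n) I"
      by (auto simp: blocks_in_def block_append[where n = n] block_append_last assms less_Suc_eq)
  qed (auto simp: blocks_in_def)
  then show ?thesis by (simp add: sum.cartesian_product)
qed

text \<open>The distributive law over independent blocks. With probability distributions for
  \<open>h i\<close> it says that their product has mass 1.\<close>

lemma sum_prod_blocks:
  fixes h :: "nat \<Rightarrow> 'a list \<Rightarrow> 'b list \<Rightarrow> real"
  assumes "\<forall>a\<in>I. length a = k" "\<forall>b\<in>J. length b = k"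
  shows "(\<Sum>x\<in>blocks_in k n I. \<Sum>y\<in>blocks_in k n J. \<Prod>i<n. h i (block k x i) (block k y i))
       = (\<Prod>i<n. \<Sum>a\<in>I. \<Sum>b\<in>J. h i a b)"
proof (induction n)
  case 0
  have "blocks_in k 0 I = {[]}" "blocks_in k 0 J = {[]}" by (auto simp: blocks_in_def)
  then show ?case by simp
next
  case (Suc n)
  have "(\<Sum>x\<in>blocks_in k (Suc n) I. \<Sum>y\<in>blocks_in k (Suc n) J. \<Prod>i<Suc n. h i (block k x i) (block k y i))
      = (\<Sum>x\<in>blocks_in k n I. \<Sum>a\<in>I. \<Sum>y\<in>blocks_in k n J. \<Sum>b\<in>J.
          (\<Prod>i<n. h i (block k x i) (block k y i)) * h n a b)"
    unfolding sum_blocks_in_Suc[OF assms(1)] sum_blocks_in_Suc[OF assms(2)]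
    by (intro sum.cong refl)
       (simp_all add: assms block_append[where n = n] block_append_last blocks_in_def)
  also have "\<dots> = (\<Sum>x\<in>blocks_in k n I. \<Sum>y\<in>blocks_in k n J.
          (\<Prod>i<n. h i (block k x i) (block k y i)) * (\<Sum>a\<in>I. \<Sum>b\<in>J. h n a b))"
    unfolding sum_distrib_left by (intro sum.cong refl sum.swap)
  also have "\<dots> = (\<Prod>i<Suc n. \<Sum>a\<in>I. \<Sum>b\<in>J. h i a b)"
    by (simp add: Suc.IH[symmetric] sum_distrib_right)
  finally show ?case .
qed

text \<open>Operator norms are submultiplicative under tensor products: the last factor acts on the
  last block alone and the others on the first \<open>n\<close> blocks, so the two can be applied
  one after the other.\<close>

lemma op_bounded_blocks:
  fixes M :: "nat \<Rightarrow> 'a list \<Rightarrow> 'b list \<Rightarrow> real"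
  assumes len: "\<forall>a\<in>I. length a = k" "\<forall>b\<in>J. length b = k"
    and M: "\<And>i. i < n \<Longrightarrow> op_bounded I J (M i) (c i)"
  shows "op_bounded (blocks_in k n I) (blocks_in k n J)
           (\<lambda>x y. \<Prod>i<n. M i (block k x i) (block k y i)) (\<Prod>i<n. c i)"
  using M
proof (induction n)
  case 0
  have "blocks_in k 0 I = {[]}" "blocks_in k 0 J = {[]}" by (auto simp: blocks_in_def)
  then show ?case
    by (simp add: op_bounded_def L2_set_def abs_mult)
next
  case (Suc n)
  define X where "X = blocks_in k n I"
  define Y where "Y = blocks_in k n J"
  define T where "T = (\<lambda>x y. \<Prod>i<n. M i (block k x i) (block k y i))"
  define C where "C = (\<Prod>i<n. c i)"
  have T: "op_bounded X Y T C" and Mn: "op_bounded I J (M n) (c n)"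
    using Suc by (auto simp: X_def Y_def T_def C_def)
  have C: "0 \<le> C" "0 \<le> c n"
    using T Mn by (auto simp: op_bounded_def)
  have L2_Suc: "L2_set w (blocks_in k (Suc n) S)
      = L2_set (\<lambda>b. L2_set (\<lambda>y. w (y @ b)) (blocks_in k n S)) S"
    if "\<forall>a\<in>S. length a = k" for w and S :: "'z list set"
  proof -
    have "(\<Sum>x\<in>blocks_in k (Suc n) S. (w x)\<^sup>2) = (\<Sum>b\<in>S. \<Sum>x\<in>blocks_in k n S. (w (x @ b))\<^sup>2)"
      unfolding sum_blocks_in_Suc[OF that] by (rule sum.swap)
    then show ?thesis by (simp add: L2_set_def sum_nonneg)
  qed
  show ?case
    unfolding op_bounded_def
  proof (intro conjI allI)
    show "0 \<le> prod c {..<Suc n}" using C by (simp add: C_def)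
  next
    fix u v
    \<comment> \<open>\<open>u'\<close> is \<open>u\<close> after the last factor has acted; for
      each last block \<open>b\<close> of the column index it is a test vector for the tensor
      product \<open>T\<close> of the first \<open>n\<close> factors.\<close>
    define u' where "u' x b = (\<Sum>a\<in>I. u (x @ a) * M n a b)" for x b
    have u': "L2_set (\<lambda>b. L2_set (\<lambda>x. u' x b) X) J \<le> c n * L2_set u (blocks_in k (Suc n) I)"
    proof -
      have "L2_set (\<lambda>b. L2_set (\<lambda>x. u' x b) X) J = L2_set (\<lambda>x. L2_set (\<lambda>b. u' x b) J) X"
        unfolding L2_set_def by (simp add: sum_nonneg) (rule sum.swap)
      also have "\<dots> \<le> L2_set (\<lambda>x. c n * L2_set (\<lambda>a. u (x @ a)) I) X"
        unfolding u'_def by (intro L2_set_mono op_bounded_L2_set_le[OF Mn]) simp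
      also have "\<dots> = c n * L2_set (\<lambda>x. L2_set (\<lambda>a. u (x @ a)) I) X"
        using C by (intro L2_set_right_distrib[symmetric])
      also have "L2_set (\<lambda>x. L2_set (\<lambda>a. u (x @ a)) I) X = L2_set u (blocks_in k (Suc n) I)"
        unfolding L2_set_def sum_blocks_in_Suc[OF len(1)] X_def by (simp add: sum_nonneg)
      finally show ?thesis .
    qed
    have "(\<Sum>x\<in>blocks_in k (Suc n) I. \<Sum>y\<in>blocks_in k (Suc n) J.
            u x * (\<Prod>i<Suc n. M i (block k x i) (block k y i)) * v y)
        = (\<Sum>x\<in>X. \<Sum>a\<in>I. \<Sum>y\<in>Y. \<Sum>b\<in>J. u (x @ a) * M n a b * T x y * v (y @ b))"
      unfolding sum_blocks_in_Suc[OF len(1)] sum_blocks_in_Suc[OF len(2)] X_def Y_def T_def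
      by (intro sum.cong refl)
         (simp_all add: len block_append[where n = n] block_append_last blocks_in_def)
    also have "\<dots> = (\<Sum>x\<in>X. \<Sum>y\<in>Y. \<Sum>b\<in>J. \<Sum>a\<in>I. u (x @ a) * M n a b * T x y * v (y @ b))"
    proof (intro sum.cong refl)
      fix x
      show "(\<Sum>a\<in>I. \<Sum>y\<in>Y. \<Sum>b\<in>J. u (x @ a) * M n a b * T x y * v (y @ b))
          = (\<Sum>y\<in>Y. \<Sum>b\<in>J. \<Sum>a\<in>I. u (x @ a) * M n a b * T x y * v (y @ b))"
        by (subst sum.swap) (intro sum.cong refl sum.swap)
    qed
    also have "\<dots> = (\<Sum>x\<in>X. \<Sum>y\<in>Y. \<Sum>b\<in>J. u' x b * T x y * v (y @ b))"
      by (simp add: u'_def sum_distrib_right)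
    also have "\<dots> = (\<Sum>x\<in>X. \<Sum>b\<in>J. \<Sum>y\<in>Y. u' x b * T x y * v (y @ b))"
      by (intro sum.cong refl sum.swap)
    also have "\<dots> = (\<Sum>b\<in>J. \<Sum>x\<in>X. \<Sum>y\<in>Y. u' x b * T x y * v (y @ b))"
      by (rule sum.swap)
    also have "\<bar>\<dots>\<bar> \<le> (\<Sum>b\<in>J. C * (L2_set (\<lambda>x. u' x b) X * L2_set (\<lambda>y. v (y @ b)) Y))"
      using T by (intro order_trans[OF sum_abs[where A = J]] sum_mono op_bounded_le)
    also have "\<dots> = C * (\<Sum>b\<in>J. \<bar>L2_set (\<lambda>x. u' x b) X\<bar> * \<bar>L2_set (\<lambda>y. v (y @ b)) Y\<bar>)"
      by (simp add: sum_distrib_left)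
    also have "\<dots> \<le> C * (L2_set (\<lambda>b. L2_set (\<lambda>x. u' x b) X) J
                        * L2_set (\<lambda>b. L2_set (\<lambda>y. v (y @ b)) Y) J)"
      using C by (intro mult_left_mono L2_set_mult_ineq)
    also have "\<dots> \<le> C * ((c n * L2_set u (blocks_in k (Suc n) I)) * L2_set v (blocks_in k (Suc n) J))"
      using C u' L2_Suc[OF len(2), of v]
      by (intro mult_left_mono mult_mono) (auto simp: Y_def)
    finally show "\<bar>\<Sum>x\<in>blocks_in k (Suc n) I. \<Sum>y\<in>blocks_in k (Suc n) J.
            u x * (\<Prod>i<Suc n. M i (block k x i) (block k y i)) * v y\<bar>
        \<le> prod c {..<Suc n} * (L2_set u (blocks_in k (Suc n) I) * L2_set v (blocks_in k (Suc n) J))"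
      by (simp add: C_def mult_ac)
  qed
qed

lemma card_blocks_in:
  assumes "\<forall>a\<in>I. length a = k"
  shows "card (blocks_in k n I) = card I ^ n"
proof (induction n)
  case 0 show ?case by (simp add: blocks_in_def)
next
  case (Suc n)
  have "card (blocks_in k (Suc n) I) = (\<Sum>x\<in>blocks_in k (Suc n) I. 1)" by simp
  also have "\<dots> = (\<Sum>x\<in>blocks_in k n I. \<Sum>a\<in>I. 1)"
    by (rule sum_blocks_in_Suc) (rule assms)
  finally show ?case using Suc by simp
qed

section \<open>Protocols as sums of local forms\<close>

text \<open>Basis states are sets of qubits, so the pair \<open>(z \<inter> A, z - A)\<close> is
  what identifies the joint space with the tensor product of the two players' spaces.\<close>

lemma sum_Pow_split:
  fixes h :: "'a set \<Rightarrow> 'a set \<Rightarrow> 'b::comm_monoid_add"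
  assumes "A \<subseteq> N"
  shows "(\<Sum>z\<in>Pow N. h (z \<inter> A) (z - A)) = (\<Sum>a\<in>Pow A. \<Sum>b\<in>Pow (N - A). h a b)"
proof -
  have "(\<Sum>z\<in>Pow N. h (z \<inter> A) (z - A)) = (\<Sum>(a, b)\<in>Pow A \<times> Pow (N - A). h a b)"
    by (rule sum.reindex_bij_witness[of _ "\<lambda>(a, b). a \<union> b" "\<lambda>z. (z \<inter> A, z - A)"])
       (use assms in \<open>auto simp: Int_Un_distrib2 Un_Diff Diff_triv intro!: arg_cong2[where f = h]\<close>)
  then show ?thesis by (simp add: sum.cartesian_product)
qed

text \<open>For \<open>b = False\<close> this sets the qubit correctly only if \<open>q\<close> is
  not in \<open>z\<close>; only such \<open>z\<close> matter below.\<close>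

definition with_qubit :: "nat \<Rightarrow> bool \<Rightarrow> nat set \<Rightarrow> nat set" where
  "with_qubit q b z = (if b then insert q z else z)"

lemma sum_Pow_qubit:
  fixes h :: "nat set \<Rightarrow> 'b::comm_monoid_add"
  assumes "q \<in> A"
  shows "(\<Sum>z\<in>Pow A. if (q \<in> z) = b then h z else 0) = (\<Sum>z\<in>Pow (A - {q}). h (with_qubit q b z))"
proof (cases "finite A")
  case True
  then have "(\<Sum>z\<in>Pow A. if (q \<in> z) = b then h z else 0) = (\<Sum>z\<in>{z \<in> Pow A. (q \<in> z) = b}. h z)"
    using sum.inter_filter[of "Pow A" h "\<lambda>z. (q \<in> z) = b"] by simp
  also have "\<dots> = (\<Sum>z\<in>Pow (A - {q}). h (with_qubit q b z))"
    by (rule sum.reindex_bij_witness[of _ "with_qubit q b" "\<lambda>z. z - {q}"])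
       (use assms in \<open>auto simp: with_qubit_def insert_absorb\<close>)
  finally show ?thesis .
next
  case False
  then show ?thesis by (simp add: finite_Pow_iff)
qed

section \<open>Contractions of one player\<close>

text \<open>Contractions instead of unitaries, because measuring and handing over a qubit produce
  projections, matrix units and blocks of operators; contractions are closed under all of
  this.\<close>

definition contraction_on :: "nat set \<Rightarrow> qoperator \<Rightarrow> bool" where
  "contraction_on S M \<longleftrightarrow>
     (\<forall>v. (\<Sum>s\<in>Pow S. (cmod (\<Sum>t\<in>Pow S. M s t * v t))\<^sup>2) \<le> (\<Sum>t\<in>Pow S. (cmod (v t))\<^sup>2))"

lemma contraction_on_compose:
  assumes "contraction_on S M" "contraction_on S M'"
  shows "contraction_on S (\<lambda>s t. \<Sum>u\<in>Pow S. M s u * M' u t)"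
  unfolding contraction_on_def
proof
  fix v
  have "(\<Sum>t\<in>Pow S. (\<Sum>u\<in>Pow S. M s u * M' u t) * v t)
      = (\<Sum>u\<in>Pow S. M s u * (\<Sum>t\<in>Pow S. M' u t * v t))" for s
    unfolding sum_distrib_left sum_distrib_right mult.assoc by (rule sum.swap)
  then have "(\<Sum>s\<in>Pow S. (cmod (\<Sum>t\<in>Pow S. (\<Sum>u\<in>Pow S. M s u * M' u t) * v t))\<^sup>2)
      = (\<Sum>s\<in>Pow S. (cmod (\<Sum>u\<in>Pow S. M s u * (\<Sum>t\<in>Pow S. M' u t * v t)))\<^sup>2)"
    by simp
  also have "\<dots> \<le> (\<Sum>u\<in>Pow S. (cmod (\<Sum>t\<in>Pow S. M' u t * v t))\<^sup>2)"
    using assms(1) by (simp add: contraction_on_def)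
  also have "\<dots> \<le> (\<Sum>t\<in>Pow S. (cmod (v t))\<^sup>2)"
    using assms(2) by (simp add: contraction_on_def)
  finally show "(\<Sum>s\<in>Pow S. (cmod (\<Sum>t\<in>Pow S. (\<Sum>u\<in>Pow S. M s u * M' u t) * v t))\<^sup>2)
      \<le> (\<Sum>t\<in>Pow S. (cmod (v t))\<^sup>2)" .
qed

text \<open>The squared norm of the image \<open>w\<close> is the pairing of \<open>v\<close> with
  \<open>M\<close> applied to the conjugate of \<open>w\<close>; Cauchy-Schwarz and the bound for
  \<open>M\<close> cancel one factor. The plain transpose, without conjugation, is what acts on the
  conjugated state in a local form.\<close>

lemma contraction_on_transpose:
  assumes "contraction_on S M"
  shows "contraction_on S (\<lambda>s t. M t s)"
  unfolding contraction_on_def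
proof
  fix v
  define w where "w s = (\<Sum>t\<in>Pow S. M t s * v t)" for s
  define b where "b = L2_set (\<lambda>s. cmod (w s)) (Pow S)"
  define c where "c = L2_set (\<lambda>s. cmod (v s)) (Pow S)"
  have "complex_of_real (b\<^sup>2) = (\<Sum>s\<in>Pow S. w s * cnj (w s))"
    by (simp add: b_def L2_set_def sum_nonneg complex_norm_square[symmetric])
  also have "\<dots> = (\<Sum>s\<in>Pow S. \<Sum>t\<in>Pow S. M t s * v t * cnj (w s))"
    by (simp add: w_def sum_distrib_right)
  also have "\<dots> = (\<Sum>t\<in>Pow S. v t * (\<Sum>s\<in>Pow S. M t s * cnj (w s)))"
    by (subst sum.swap) (simp add: sum_distrib_left mult_ac)
  finally have "b\<^sup>2 = cmod (\<Sum>t\<in>Pow S. v t * (\<Sum>s\<in>Pow S. M t s * cnj (w s)))"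
    by (metis norm_of_real abs_of_nonneg zero_le_power2)
  also have "\<dots> \<le> (\<Sum>t\<in>Pow S. \<bar>cmod (v t)\<bar> * \<bar>cmod (\<Sum>s\<in>Pow S. M t s * cnj (w s))\<bar>)"
    by (rule order_trans[OF norm_sum]) (simp add: norm_mult)
  also have "\<dots> \<le> c * L2_set (\<lambda>t. cmod (\<Sum>s\<in>Pow S. M t s * cnj (w s))) (Pow S)"
    unfolding c_def by (rule L2_set_mult_ineq)
  also have "\<dots> \<le> c * L2_set (\<lambda>s. cmod (cnj (w s))) (Pow S)"
    using assms unfolding contraction_on_def
    by (intro mult_left_mono) (simp_all add: L2_set_def c_def sum_nonneg del: complex_mod_cnj)
  finally have "b * b \<le> c * b"
    by (simp add: b_def power2_eq_square)
  moreover have "0 \<le> b" "0 \<le> c" by (auto simp: b_def c_def)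
  ultimately have "b\<^sup>2 \<le> c\<^sup>2"
    by (cases "b = 0") (auto simp: mult_le_cancel_right intro!: power_mono)
  then show "(\<Sum>s\<in>Pow S. (cmod (\<Sum>t\<in>Pow S. M t s * v t))\<^sup>2) \<le> (\<Sum>t\<in>Pow S. (cmod (v t))\<^sup>2)"
    by (simp add: b_def c_def L2_set_def sum_nonneg w_def)
qed

lemma contraction_on_qubit_projection:
  assumes "finite S"
  shows "contraction_on S (\<lambda>s t. of_bool (s = t \<and> (q \<in> s) = b))"
  unfolding contraction_on_def
proof
  fix v :: "nat set \<Rightarrow> complex"
  have "(\<Sum>t\<in>Pow S. of_bool (s = t \<and> (q \<in> s) = b) * v t) = of_bool ((q \<in> s) = b) * v s"
    if "s \<in> Pow S" for s
    using assms that by (cases "(q \<in> s) = b") (simp_all add: of_bool_def if_distrib[of "\<lambda>c. c * _"] cong: if_cong)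
  then show "(\<Sum>s\<in>Pow S. (cmod (\<Sum>t\<in>Pow S. of_bool (s = t \<and> (q \<in> s) = b) * v t))\<^sup>2)
      \<le> (\<Sum>t\<in>Pow S. (cmod (v t))\<^sup>2)"
    by (intro sum_mono) (simp add: norm_mult)
qed

lemma contraction_on_id:
  assumes "finite S"
  shows "contraction_on S (\<lambda>s t. of_bool (s = t))"
proof -
  have "(\<Sum>t\<in>Pow S. of_bool (s = t) * v t) = v s" if "s \<in> Pow S" for s and v :: "nat set \<Rightarrow> complex"
    using assms that by (simp add: of_bool_def if_distrib[of "\<lambda>c. c * _"] cong: if_cong)
  then show ?thesis by (simp add: contraction_on_def)
qed

text \<open>The matrix unit with row \<open>a\<close> and column \<open>b\<close> on qubit
  \<open>q\<close>, tensored with \<open>S\<close> on the other qubits.\<close>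

definition extend_by :: "nat \<Rightarrow> bool \<Rightarrow> bool \<Rightarrow> qoperator \<Rightarrow> qoperator" where
  "extend_by q a b S = (\<lambda>s t. of_bool ((q \<in> s) = a \<and> (q \<in> t) = b) * S (s - {q}) (t - {q}))"

text \<open>Three operations that do not increase the norm: keep the slice where \<open>q\<close>
  has value \<open>b\<close>, apply \<open>M\<close> there, place the result in the slice with value
  \<open>a\<close>.\<close>

lemma contraction_on_extend_by:
  assumes "contraction_on (A - {q}) M" "q \<in> A"
  shows "contraction_on A (extend_by q a b M)"
  unfolding contraction_on_def extend_by_def
proof (intro allI, cases "finite A")
  fix v :: "nat set \<Rightarrow> complex"
  assume "finite A"
  define w where "w z = v (with_qubit q b z)" for z
  have M: "(\<Sum>t\<in>Pow A. of_bool ((q \<in> s) = a \<and> (q \<in> t) = b) * M (s - {q}) (t - {q}) * v t)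
      = (if (q \<in> s) = a then \<Sum>t\<in>Pow (A - {q}). M (s - {q}) t * w t else 0)" for s
  proof -
    have "(\<Sum>t\<in>Pow A. of_bool ((q \<in> s) = a \<and> (q \<in> t) = b) * M (s - {q}) (t - {q}) * v t)
        = of_bool ((q \<in> s) = a) * (\<Sum>t\<in>Pow A. if (q \<in> t) = b then M (s - {q}) (t - {q}) * v t else 0)"
      by (auto simp: sum_distrib_left intro!: sum.cong)
    also have "\<dots> = of_bool ((q \<in> s) = a) * (\<Sum>t\<in>Pow (A - {q}). M (s - {q}) (with_qubit q b t - {q}) * w t)"
      unfolding sum_Pow_qubit[OF assms(2)] w_def ..
    also have "(\<Sum>t\<in>Pow (A - {q}). M (s - {q}) (with_qubit q b t - {q}) * w t)
        = (\<Sum>t\<in>Pow (A - {q}). M (s - {q}) t * w t)"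
      by (intro sum.cong) (auto simp: with_qubit_def intro!: arg_cong2[where f = M])
    finally show ?thesis by simp
  qed
  have "(\<Sum>s\<in>Pow A. (cmod (\<Sum>t\<in>Pow A. of_bool ((q \<in> s) = a \<and> (q \<in> t) = b) * M (s - {q}) (t - {q}) * v t))\<^sup>2)
      = (\<Sum>s\<in>Pow A. if (q \<in> s) = a then (cmod (\<Sum>t\<in>Pow (A - {q}). M (s - {q}) t * w t))\<^sup>2 else 0)"
    unfolding M by (intro sum.cong) auto
  also have "\<dots> = (\<Sum>s\<in>Pow (A - {q}). (cmod (\<Sum>t\<in>Pow (A - {q}). M s t * w t))\<^sup>2)"
    unfolding sum_Pow_qubit[OF assms(2)]
    by (intro sum.cong refl arg_cong[where f = "\<lambda>z. (cmod z)\<^sup>2"] arg_cong2[where f = "(*)"] arg_cong2[where f = M])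
       (auto simp: with_qubit_def)
  also have "\<dots> \<le> (\<Sum>t\<in>Pow (A - {q}). (cmod (w t))\<^sup>2)"
    using assms(1) by (simp add: contraction_on_def)
  also have "\<dots> = (\<Sum>t\<in>Pow A. if (q \<in> t) = b then (cmod (v t))\<^sup>2 else 0)"
    unfolding sum_Pow_qubit[OF assms(2)] w_def ..
  also have "\<dots> \<le> (\<Sum>t\<in>Pow A. (cmod (v t))\<^sup>2)"
    by (intro sum_mono) auto
  finally show "(\<Sum>s\<in>Pow A. (cmod (\<Sum>t\<in>Pow A. of_bool ((q \<in> s) = a \<and> (q \<in> t) = b) * M (s - {q}) (t - {q}) * v t))\<^sup>2)
      \<le> (\<Sum>t\<in>Pow A. (cmod (v t))\<^sup>2)" .
qed (simp add: finite_Pow_iff)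

text \<open>The \<open>(a, b)\<close> block of \<open>T\<close> with respect to qubit
  \<open>q\<close>, as an operator on the remaining qubits.\<close>

definition block_of :: "nat \<Rightarrow> bool \<Rightarrow> bool \<Rightarrow> qoperator \<Rightarrow> qoperator" where
  "block_of q a b T = (\<lambda>s t. T (with_qubit q a s) (with_qubit q b t))"

text \<open>A block is a compression: embed the vector into the slice with value \<open>b\<close>,
  apply \<open>M\<close>, discard all but the slice with value \<open>a\<close>.\<close>

lemma contraction_on_block_of:
  assumes "contraction_on (insert q B) M" "q \<notin> B"
  shows "contraction_on B (block_of q a b M)"
  unfolding contraction_on_def block_of_def
proof
  fix v :: "nat set \<Rightarrow> complex"
  define w where "w z = (if (q \<in> z) = b then v (z - {q}) else 0)" for z
  have q: "q \<in> insert q B" "insert q B - {q} = B" using assms(2) by auto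
  have minus: "v (with_qubit q b t - {q}) = v t" if "t \<in> Pow B" for t
    using assms(2) that by (intro arg_cong[where f = v]) (auto simp: with_qubit_def)
  have "(\<Sum>t\<in>Pow B. M s (with_qubit q b t) * v t) = (\<Sum>t\<in>Pow (insert q B). M s t * w t)" for s
  proof -
    have "(\<Sum>t\<in>Pow (insert q B). M s t * w t)
        = (\<Sum>t\<in>Pow (insert q B). if (q \<in> t) = b then M s t * v (t - {q}) else 0)"
      by (intro sum.cong) (auto simp: w_def)
    also have "\<dots> = (\<Sum>t\<in>Pow B. M s (with_qubit q b t) * v (with_qubit q b t - {q}))"
      unfolding sum_Pow_qubit[OF q(1)] q(2) ..
    finally show ?thesis by (simp add: minus)
  qed
  then have "(\<Sum>s\<in>Pow B. (cmod (\<Sum>t\<in>Pow B. M (with_qubit q a s) (with_qubit q b t) * v t))\<^sup>2)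
      = (\<Sum>s\<in>Pow B. (cmod (\<Sum>t\<in>Pow (insert q B). M (with_qubit q a s) t * w t))\<^sup>2)"
    by simp
  also have "\<dots> = (\<Sum>s\<in>Pow (insert q B). if (q \<in> s) = a then (cmod (\<Sum>t\<in>Pow (insert q B). M s t * w t))\<^sup>2 else 0)"
    unfolding sum_Pow_qubit[OF q(1)] q(2) ..
  also have "\<dots> \<le> (\<Sum>s\<in>Pow (insert q B). (cmod (\<Sum>t\<in>Pow (insert q B). M s t * w t))\<^sup>2)"
    by (intro sum_mono) auto
  also have "\<dots> \<le> (\<Sum>t\<in>Pow (insert q B). (cmod (w t))\<^sup>2)"
    using assms(1) by (simp add: contraction_on_def)
  also have "\<dots> = (\<Sum>t\<in>Pow (insert q B). if (q \<in> t) = b then (cmod (v (t - {q})))\<^sup>2 else 0)"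
    by (intro sum.cong) (auto simp: w_def)
  also have "\<dots> = (\<Sum>t\<in>Pow B. (cmod (v t))\<^sup>2)"
    unfolding sum_Pow_qubit[OF q(1)] q(2) by (simp add: minus)
  finally show "(\<Sum>s\<in>Pow B. (cmod (\<Sum>t\<in>Pow B. M (with_qubit q a s) (with_qubit q b t) * v t))\<^sup>2)
      \<le> (\<Sum>t\<in>Pow B. (cmod (v t))\<^sup>2)" .
qed

lemma unitary_on_isometry:
  assumes "unitary_on S U" "finite S"
  shows "(\<Sum>s\<in>Pow S. (cmod (\<Sum>t\<in>Pow S. U s t * v t))\<^sup>2) = (\<Sum>t\<in>Pow S. (cmod (v t))\<^sup>2)"
proof -
  have "complex_of_real (\<Sum>s\<in>Pow S. (cmod (\<Sum>t\<in>Pow S. U s t * v t))\<^sup>2)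
      = (\<Sum>s\<in>Pow S. (\<Sum>t\<in>Pow S. U s t * v t) * (\<Sum>w\<in>Pow S. cnj (U s w) * cnj (v w)))"
    by (simp only: of_real_sum complex_norm_square cnj_sum complex_cnj_mult)
  also have "\<dots> = (\<Sum>s\<in>Pow S. \<Sum>t\<in>Pow S. \<Sum>w\<in>Pow S. v t * cnj (v w) * (cnj (U s w) * U s t))"
    by (simp add: sum_product mult_ac)
  also have "\<dots> = (\<Sum>t\<in>Pow S. \<Sum>s\<in>Pow S. \<Sum>w\<in>Pow S. v t * cnj (v w) * (cnj (U s w) * U s t))"
    by (rule sum.swap)
  also have "\<dots> = (\<Sum>t\<in>Pow S. \<Sum>w\<in>Pow S. \<Sum>s\<in>Pow S. v t * cnj (v w) * (cnj (U s w) * U s t))"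
    by (intro sum.cong refl sum.swap)
  also have "\<dots> = (\<Sum>t\<in>Pow S. \<Sum>w\<in>Pow S. v t * cnj (v w) * of_bool (w = t))"
    using assms(1) unfolding sum_distrib_left[symmetric] unitary_on_def by (intro sum.cong refl) auto
  also have "\<dots> = (\<Sum>t\<in>Pow S. v t * cnj (v t))"
    using assms(2) by (intro sum.cong refl) (simp add: of_bool_def if_distrib[of "\<lambda>c. _ * c"] cong: if_cong)
  also have "\<dots> = complex_of_real (\<Sum>t\<in>Pow S. (cmod (v t))\<^sup>2)"
    by (simp only: of_real_sum complex_norm_square)
  finally show ?thesis using of_real_eq_iff by blast
qed

lemma unitary_on_adjoint: "unitary_on S U \<Longrightarrow> unitary_on S (\<lambda>s t. cnj (U t s))"
  unfolding unitary_on_def by simp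

lemma unitary_on_contraction:
  assumes "unitary_on S U" "finite S"
  shows "contraction_on S U"
  using unitary_on_isometry[OF assms] by (simp add: contraction_on_def)

section \<open>Local forms and the Heisenberg picture\<close>

text \<open>This is the inner product of \<open>\<psi>\<close> with \<open>S\<close> tensor
  \<open>T\<close> applied to \<open>\<psi>\<close>.\<close>

definition local_form :: "nat \<Rightarrow> nat set \<Rightarrow> qoperator \<Rightarrow> qoperator \<Rightarrow> qstate \<Rightarrow> complex" where
  "local_form N A S T \<psi> = (\<Sum>z\<in>Pow {..<N}. \<Sum>w\<in>Pow {..<N}.
     cnj (\<psi> z) * S (z \<inter> A) (w \<inter> A) * T (z - A) (w - A) * \<psi> w)"

text \<open>Through this symmetry everything is proved for Alice and transported to Bob.\<close>

lemma local_form_swap: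
  assumes "A \<subseteq> {..<N}"
  shows "local_form N ({..<N} - A) T S \<psi> = local_form N A S T \<psi>"
proof -
  have "z \<inter> ({..<N} - A) = z - A" "z - ({..<N} - A) = z \<inter> A" if "z \<in> Pow {..<N}" for z
    using that assms by auto
  then show ?thesis by (simp add: local_form_def mult_ac)
qed

lemma local_form_split:
  assumes "A \<subseteq> {..<N}"
  shows "local_form N A S T \<psi> = (\<Sum>a\<in>Pow A. \<Sum>b\<in>Pow ({..<N} - A). \<Sum>a'\<in>Pow A. \<Sum>b'\<in>Pow ({..<N} - A).
           cnj (\<psi> (a \<union> b)) * S a a' * T b b' * \<psi> (a' \<union> b'))"
proof -
  have "local_form N A S T \<psi> = (\<Sum>z\<in>Pow {..<N}. \<Sum>w\<in>Pow {..<N}.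
     cnj (\<psi> ((z \<inter> A) \<union> (z - A))) * S (z \<inter> A) (w \<inter> A) * T (z - A) (w - A) * \<psi> ((w \<inter> A) \<union> (w - A)))"
    unfolding Int_Diff_Un local_form_def ..
  also have "\<dots> = (\<Sum>z\<in>Pow {..<N}. \<Sum>a'\<in>Pow A. \<Sum>b'\<in>Pow ({..<N} - A).
     cnj (\<psi> ((z \<inter> A) \<union> (z - A))) * S (z \<inter> A) a' * T (z - A) b' * \<psi> (a' \<union> b'))"
    by (intro sum.cong refl sum_Pow_split[OF assms])
  also have "\<dots> = (\<Sum>a\<in>Pow A. \<Sum>b\<in>Pow ({..<N} - A). \<Sum>a'\<in>Pow A. \<Sum>b'\<in>Pow ({..<N} - A).
           cnj (\<psi> (a \<union> b)) * S a a' * T b b' * \<psi> (a' \<union> b'))"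
    by (rule sum_Pow_split[OF assms])
  finally show ?thesis .
qed

lemma apply_local_Un:
  assumes "a \<subseteq> A" "b \<inter> A = {}"
  shows "apply_local A U \<psi> (a \<union> b) = (\<Sum>s\<in>Pow A. U a s * \<psi> (s \<union> b))"
proof -
  have "(a \<union> b) \<inter> A = a" "(a \<union> b) - A = b" using assms by auto
  then show ?thesis by (simp add: apply_local_def)
qed

text \<open>The adjoint of \<open>U\<close>, times \<open>S\<close>, times \<open>U\<close>. The
  nesting of the sums makes it literally two compositions in the sense of
  \<open>contraction_on_compose\<close>.\<close>

definition conjugate_by :: "nat set \<Rightarrow> qoperator \<Rightarrow> qoperator \<Rightarrow> qoperator" where
  "conjugate_by A U S = (\<lambda>s s'. \<Sum>a\<in>Pow A. cnj (U a s) * (\<Sum>a'\<in>Pow A. S a a' * U a' s'))"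

lemma contraction_on_conjugate_by:
  assumes "unitary_on A U" "finite A" "contraction_on A S"
  shows "contraction_on A (conjugate_by A U S)"
  unfolding conjugate_by_def
  by (rule contraction_on_compose[OF unitary_on_contraction[OF unitary_on_adjoint[OF assms(1)] assms(2)]
        contraction_on_compose[OF assms(3) unitary_on_contraction[OF assms(1,2)]]])

text \<open>\<open>U\<close> acts on \<open>A\<close> only, so moving it from the state to the
  operators changes \<open>S\<close> and leaves \<open>T\<close> alone; the rest is reordering of
  finite sums.\<close>

lemma local_form_apply_local:
  assumes A: "A \<subseteq> {..<N}"
  shows "local_form N A S T (apply_local A U \<psi>) = local_form N A (conjugate_by A U S) T \<psi>"
proof -
  define B where "B = {..<N} - A"
  \<comment> \<open>Contracting the state with \<open>T\<close> first leaves a matrix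
    \<open>F\<close> on Alice's side, against which the form is linear in \<open>S\<close>.\<close>
  define F where "F a a' = (\<Sum>b\<in>Pow B. \<Sum>b'\<in>Pow B. cnj (\<psi> (a \<union> b)) * T b b' * \<psi> (a' \<union> b'))" for a a'
  have form: "local_form N A R T \<phi> = (\<Sum>a\<in>Pow A. \<Sum>a'\<in>Pow A. R a a' *
      (\<Sum>b\<in>Pow B. \<Sum>b'\<in>Pow B. cnj (\<phi> (a \<union> b)) * T b b' * \<phi> (a' \<union> b')))" for R \<phi>
  proof -
    have "local_form N A R T \<phi> = (\<Sum>a\<in>Pow A. \<Sum>a'\<in>Pow A. \<Sum>b\<in>Pow B. \<Sum>b'\<in>Pow B.
           cnj (\<phi> (a \<union> b)) * R a a' * T b b' * \<phi> (a' \<union> b'))"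
      unfolding local_form_split[OF A] B_def by (intro sum.cong refl sum.swap)
    then show ?thesis by (simp add: sum_distrib_left mult_ac)
  qed
  have "local_form N A S T (apply_local A U \<psi>) = (\<Sum>a\<in>Pow A. \<Sum>a'\<in>Pow A. S a a' *
      (\<Sum>b\<in>Pow B. \<Sum>b'\<in>Pow B. \<Sum>s\<in>Pow A. \<Sum>s'\<in>Pow A.
         cnj (U a s) * U a' s' * (cnj (\<psi> (s \<union> b)) * T b b' * \<psi> (s' \<union> b'))))"
    unfolding form
  proof (intro sum.cong refl arg_cong2[where f = "(*)"])
    fix a a' b b' assume "a \<in> Pow A" "a' \<in> Pow A" "b \<in> Pow B" "b' \<in> Pow B"
    then have "a \<subseteq> A" "a' \<subseteq> A" "b \<inter> A = {}" "b' \<inter> A = {}" by (auto simp: B_def)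
    then show "cnj (apply_local A U \<psi> (a \<union> b)) * T b b' * apply_local A U \<psi> (a' \<union> b')
        = (\<Sum>s\<in>Pow A. \<Sum>s'\<in>Pow A. cnj (U a s) * U a' s' * (cnj (\<psi> (s \<union> b)) * T b b' * \<psi> (s' \<union> b')))"
      by (simp add: apply_local_Un sum_distrib_left sum_distrib_right mult_ac)
  qed
  also have "\<dots> = (\<Sum>a\<in>Pow A. \<Sum>a'\<in>Pow A. S a a' *
      (\<Sum>s\<in>Pow A. \<Sum>s'\<in>Pow A. cnj (U a s) * U a' s' * F s s'))"
  proof -
    have "(\<Sum>b\<in>Pow B. \<Sum>b'\<in>Pow B. \<Sum>s\<in>Pow A. \<Sum>s'\<in>Pow A.
          cnj (U a s) * U a' s' * (cnj (\<psi> (s \<union> b)) * T b b' * \<psi> (s' \<union> b')))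
        = (\<Sum>s\<in>Pow A. \<Sum>s'\<in>Pow A. cnj (U a s) * U a' s' * F s s')" for a a'
    proof -
      define h where "h b b' s s' = cnj (U a s) * U a' s' * (cnj (\<psi> (s \<union> b)) * T b b' * \<psi> (s' \<union> b'))" for b b' s s'
      have "(\<Sum>b\<in>Pow B. \<Sum>b'\<in>Pow B. \<Sum>s\<in>Pow A. \<Sum>s'\<in>Pow A. h b b' s s')
          = (\<Sum>b\<in>Pow B. \<Sum>s\<in>Pow A. \<Sum>b'\<in>Pow B. \<Sum>s'\<in>Pow A. h b b' s s')"
        by (intro sum.cong refl sum.swap)
      also have "\<dots> = (\<Sum>s\<in>Pow A. \<Sum>b\<in>Pow B. \<Sum>b'\<in>Pow B. \<Sum>s'\<in>Pow A. h b b' s s')"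
        by (rule sum.swap)
      also have "\<dots> = (\<Sum>s\<in>Pow A. \<Sum>b\<in>Pow B. \<Sum>s'\<in>Pow A. \<Sum>b'\<in>Pow B. h b b' s s')"
        by (intro sum.cong refl sum.swap)
      also have "\<dots> = (\<Sum>s\<in>Pow A. \<Sum>s'\<in>Pow A. \<Sum>b\<in>Pow B. \<Sum>b'\<in>Pow B. h b b' s s')"
        by (intro sum.cong refl sum.swap)
      finally show ?thesis
        by (simp add: h_def F_def sum_distrib_left)
    qed
    then show ?thesis by (simp only:)
  qed
  also have "\<dots> = (\<Sum>a\<in>Pow A. \<Sum>a'\<in>Pow A. \<Sum>s\<in>Pow A. \<Sum>s'\<in>Pow A. cnj (U a s) * S a a' * U a' s' * F s s')"
    by (simp add: sum_distrib_left mult_ac)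
  also have "\<dots> = (\<Sum>a\<in>Pow A. \<Sum>s\<in>Pow A. \<Sum>s'\<in>Pow A. \<Sum>a'\<in>Pow A. cnj (U a s) * S a a' * U a' s' * F s s')"
  proof (rule sum.cong[OF refl])
    fix a
    show "(\<Sum>a'\<in>Pow A. \<Sum>s\<in>Pow A. \<Sum>s'\<in>Pow A. cnj (U a s) * S a a' * U a' s' * F s s')
        = (\<Sum>s\<in>Pow A. \<Sum>s'\<in>Pow A. \<Sum>a'\<in>Pow A. cnj (U a s) * S a a' * U a' s' * F s s')"
      by (subst sum.swap) (intro sum.cong refl sum.swap)
  qed
  also have "\<dots> = (\<Sum>s\<in>Pow A. \<Sum>s'\<in>Pow A. \<Sum>a\<in>Pow A. \<Sum>a'\<in>Pow A. cnj (U a s) * S a a' * U a' s' * F s s')"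
    by (subst sum.swap) (intro sum.cong refl sum.swap)
  also have "\<dots> = local_form N A (conjugate_by A U S) T \<psi>"
    unfolding form F_def[symmetric]
    by (simp add: conjugate_by_def sum_distrib_left sum_distrib_right mult_ac)
  finally show ?thesis .
qed

lemma with_qubit_Diff: "z - (A - {q}) = with_qubit q (q \<in> z) (z - A)" if "q \<in> A"
  using that by (auto simp: with_qubit_def)

text \<open>A qubit changes hands by writing the operator of its later owner as a sum over the four matrix
  units \<open>|a><b|\<close> on that qubit, which the earlier owner absorbs.\<close>
lemma local_form_transfer:
  assumes "q \<in> A"
  shows "local_form N (A - {q}) S T \<psi> =
    (\<Sum>(a, b)\<leftarrow>List.product [False, True] [False, True].
       local_form N A (extend_by q a b S) (block_of q a b T) \<psi>)"
proof -
  \<comment> \<open>Only the term with \<open>a = (q \<in> z)\<close> and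
    \<open>b = (q \<in> w)\<close> can be nonzero.\<close>
  have "cnj (\<psi> z) * S (z \<inter> (A - {q})) (w \<inter> (A - {q})) * T (z - (A - {q})) (w - (A - {q})) * \<psi> w
      = (\<Sum>(a, b)\<leftarrow>List.product [False, True] [False, True].
          cnj (\<psi> z) * extend_by q a b S (z \<inter> A) (w \<inter> A) * block_of q a b T (z - A) (w - A) * \<psi> w)" for z w
    using assms by (cases "q \<in> z"; cases "q \<in> w")
      (simp_all add: extend_by_def block_of_def with_qubit_Diff Int_Diff)
  then show ?thesis
    unfolding local_form_def by (simp add: sum.distrib)
qed

text \<open>\<open>G x y\<close> is a quadratic form of the state: the measurement outcome in the Heisenberg picture.\<close>
definition decomposes ::
  "nat \<Rightarrow> nat set \<Rightarrow> nat \<Rightarrow> ('x \<Rightarrow> 'y \<Rightarrow> qstate \<Rightarrow> complex) \<Rightarrow> bool" where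
  "decomposes N A m G \<longleftrightarrow> (\<exists>L. length L = m \<and>
     (\<forall>(S, T)\<in>set L. (\<forall>x. contraction_on A (S x)) \<and> (\<forall>y. contraction_on ({..<N} - A) (T y))) \<and>
     (\<forall>x y \<psi>. G x y \<psi> = (\<Sum>(S, T)\<leftarrow>L. local_form N A (S x) (T y) \<psi>)))"

lemma decomposes_swap:
  assumes "decomposes N A m G" "A \<subseteq> {..<N}"
  shows "decomposes N ({..<N} - A) m (\<lambda>y x. G x y)"
proof -
  obtain L where L: "length L = m"
    "\<forall>(S, T)\<in>set L. (\<forall>x. contraction_on A (S x)) \<and> (\<forall>y. contraction_on ({..<N} - A) (T y))"
    "\<forall>x y \<psi>. G x y \<psi> = (\<Sum>(S, T)\<leftarrow>L. local_form N A (S x) (T y) \<psi>)"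
    using assms(1) unfolding decomposes_def by auto
  have "{..<N} - ({..<N} - A) = A" using assms(2) by blast
  then show ?thesis
    unfolding decomposes_def using L
    by (intro exI[of _ "map prod.swap L"])
       (auto simp: comp_def case_prod_unfold local_form_swap[OF assms(2)])
qed

text \<open>The unitary acts before the remainder of the protocol, so it sits inside
  \<open>G\<close>; conjugating Alice's operators absorbs it without new terms.\<close>

lemma decomposes_apply_local:
  assumes "decomposes N A m G" "A \<subseteq> {..<N}" "\<And>x. unitary_on A (U x)"
  shows "decomposes N A m (\<lambda>x y \<psi>. G x y (apply_local A (U x) \<psi>))"
proof -
  obtain L where L: "length L = m"
    "\<forall>(S, T)\<in>set L. (\<forall>x. contraction_on A (S x)) \<and> (\<forall>y. contraction_on ({..<N} - A) (T y))"
    "\<forall>x y \<psi>. G x y \<psi> = (\<Sum>(S, T)\<leftarrow>L. local_form N A (S x) (T y) \<psi>)"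
    using assms(1) unfolding decomposes_def by auto
  have "finite A" using assms(2) finite_subset by blast
  then show ?thesis
    unfolding decomposes_def using L contraction_on_conjugate_by[OF assms(3)]
    by (intro exI[of _ "map (\<lambda>(S, T). (\<lambda>x. conjugate_by A (U x) (S x), T)) L"])
       (auto simp: comp_def case_prod_unfold local_form_apply_local[OF assms(2)])
qed

text \<open>Backwards in time: the assumption refers to the split after \<open>q\<close> has left
  \<open>A\<close>, the conclusion to the split before. Each term becomes one for each of the four
  matrix units on \<open>q\<close>.\<close>

lemma decomposes_transfer:
  assumes "decomposes N (A - {q}) m G" "A \<subseteq> {..<N}" "q \<in> A"
  shows "decomposes N A (4 * m) G"
proof -
  obtain L where L: "length L = m"
    "\<forall>(S, T)\<in>set L. (\<forall>x. contraction_on (A - {q}) (S x)) \<and> (\<forall>y. contraction_on ({..<N} - (A - {q})) (T y))"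
    "\<forall>x y \<psi>. G x y \<psi> = (\<Sum>(S, T)\<leftarrow>L. local_form N (A - {q}) (S x) (T y) \<psi>)"
    using assms(1) unfolding decomposes_def by auto
  define E where "E = (\<lambda>(S, T). map (\<lambda>(a, b). (\<lambda>x::'a. extend_by q a b (S x), \<lambda>y::'b. block_of q a b (T y)))
    (List.product [False, True] [False, True]))"
  have "{..<N} - (A - {q}) = insert q ({..<N} - A)" using assms by auto
  with L(2) have "\<forall>(S, T)\<in>set (concat (map E L)).
      (\<forall>x. contraction_on A (S x)) \<and> (\<forall>y. contraction_on ({..<N} - A) (T y))"
    by (auto intro!: contraction_on_extend_by contraction_on_block_of simp: E_def assms(3))
  moreover have "length (concat (map E L)) = 4 * m"
    unfolding L(1)[symmetric] by (induction L) (auto simp: E_def)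
  moreover have "G x y \<psi> = (\<Sum>(S, T)\<leftarrow>concat (map E L). local_form N A (S x) (T y) \<psi>)" for x y \<psi>
  proof -
    have "(\<Sum>(S, T)\<leftarrow>E p. local_form N A (S x) (T y) \<psi>)
        = (case p of (S, T) \<Rightarrow> local_form N (A - {q}) (S x) (T y) \<psi>)" for p
      by (cases p) (simp add: E_def local_form_transfer[OF assms(3)])
    then have "(\<Sum>(S, T)\<leftarrow>concat (map E L). local_form N A (S x) (T y) \<psi>)
        = (\<Sum>(S, T)\<leftarrow>L. local_form N (A - {q}) (S x) (T y) \<psi>)"
      by (induction L) auto
    then show ?thesis using L(3) by simp
  qed
  ultimately show ?thesis
    unfolding decomposes_def by blast
qed

text \<open>The end of the protocol is where the backward evolution starts: a single term, with the
  projection onto the outcome on the measuring side and the identity on the other.\<close>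

lemma decomposes_measure:
  assumes "A \<subseteq> {..<N}" "q \<in> A"
  shows "decomposes N A 1 (\<lambda>x y \<psi>. of_real (\<Sum>z \<in> {z \<in> Pow {..<N}. (q \<in> z) = b}. (cmod (\<psi> z))\<^sup>2))"
  unfolding decomposes_def
proof (intro exI[of _ "[(\<lambda>x s t. of_bool (s = t \<and> (q \<in> s) = b), \<lambda>y s t. of_bool (s = t))]"] conjI allI)
  have "finite A" using assms(1) finite_subset by blast
  then show "\<forall>(S, T)\<in>set [(\<lambda>x s t. of_bool (s = t \<and> (q \<in> s) = b), \<lambda>y s t. of_bool (s = t))].
      (\<forall>x. contraction_on A (S x)) \<and> (\<forall>y. contraction_on ({..<N} - A) (T y))"
    by (auto intro: contraction_on_qubit_projection contraction_on_id)
next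
  fix \<psi> :: qstate
  have "local_form N A (\<lambda>s t. of_bool (s = t \<and> (q \<in> s) = b)) (\<lambda>s t. of_bool (s = t)) \<psi>
      = (\<Sum>z\<in>Pow {..<N}. \<Sum>w\<in>Pow {..<N}. if z = w then (if (q \<in> z) = b then cnj (\<psi> z) * \<psi> z else 0) else 0)"
    unfolding local_form_def
  proof (intro sum.cong refl)
    fix z w
    have "(z \<inter> A = w \<inter> A \<and> z - A = w - A) = (z = w)" by blast
    then show "cnj (\<psi> z) * of_bool (z \<inter> A = w \<inter> A \<and> (q \<in> z \<inter> A) = b) * of_bool (z - A = w - A) * \<psi> w
        = (if z = w then (if (q \<in> z) = b then cnj (\<psi> z) * \<psi> z else 0) else 0)"
      using assms(2) by auto
  qed
  also have "\<dots> = (\<Sum>z\<in>Pow {..<N}. if (q \<in> z) = b then cnj (\<psi> z) * \<psi> z else 0)"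
    by (intro sum.cong refl) simp
  also have "\<dots> = (\<Sum>z\<in>{z \<in> Pow {..<N}. (q \<in> z) = b}. cnj (\<psi> z) * \<psi> z)"
    by (rule sum.inter_filter[symmetric]) simp
  finally show "of_real (\<Sum>z \<in> {z \<in> Pow {..<N}. (q \<in> z) = b}. (cmod (\<psi> z))\<^sup>2)
      = (\<Sum>(S, T)\<leftarrow>[(\<lambda>x s t. of_bool (s = t \<and> (q \<in> s) = b), \<lambda>y s t. of_bool (s = t))].
          local_form N A (S x) (T y) \<psi>)" for x y
    by (simp only: of_real_sum complex_norm_square list.map sum_list.Cons sum_list.Nil case_prod_conv add_0_right mult.commute)
qed simp

text \<open>Induction on the messages. Only these cost a factor 4, since the qubit of the final
  action is measured and not handed over.\<close>

lemma decomposes_run_actions: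
  assumes "valid_actions N A (as @ [a])" "A \<subseteq> {..<N}"
  shows "decomposes N A (4 ^ length as) (\<lambda>x y \<psi>. of_real
           (\<Sum>z \<in> {z \<in> Pow {..<N}. (selected_qubit a \<in> z) = b}. (cmod (run_actions N x y A (as @ [a]) \<psi> z))\<^sup>2))"
  using assms
proof (induction as arbitrary: A)
  case Nil
  show ?case
  proof (cases a)
    case (Alice U q)
    with Nil have "q \<in> A" "\<And>x. unitary_on A (U x)" by auto
    from decomposes_apply_local[OF decomposes_measure[OF Nil(2) this(1), of b] Nil(2) this(2)]
    show ?thesis by (simp add: Alice)
  next
    case (Bob U q)
    \<comment> \<open>Bob's case is Alice's on the complement \<open>B\<close>, with the roles
      exchanged before and after.\<close>
    define B where "B = {..<N} - A"
    have B: "B \<subseteq> {..<N}" "{..<N} - B = A" using Nil(2) by (auto simp: B_def)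
    from Bob Nil have "q \<in> B" "\<And>x. unitary_on B (U x)" by (auto simp: B_def)
    from decomposes_swap[OF decomposes_apply_local[OF decomposes_measure[OF B(1) this(1), of b] B(1) this(2)] B(1)]
    show ?thesis unfolding B(2) by (simp add: Bob B_def)
  qed
next
  case (Cons a' as)
  show ?case
  proof (cases a')
    case (Alice U q)
    with Cons.prems have q: "q \<in> A" and U: "\<And>x. unitary_on A (U x)"
      and valid: "valid_actions N (A - {q}) (as @ [a])" "A - {q} \<subseteq> {..<N}" by auto
    from decomposes_apply_local[OF decomposes_transfer[OF Cons.IH[OF valid] Cons.prems(2) q] Cons.prems(2) U]
    show ?thesis by (simp add: Alice)
  next
    case (Bob U q)
    define B where "B = {..<N} - A"
    from Bob Cons.prems have q: "q \<in> B" and U: "\<And>x. unitary_on B (U x)"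
      and valid: "valid_actions N (insert q A) (as @ [a])" "insert q A \<subseteq> {..<N}" by (auto simp: B_def)
    \<comment> \<open>That Alice receives \<open>q\<close> means, on Bob's side, that
      \<open>q\<close> is removed from \<open>B\<close>; this is the form
      \<open>decomposes_transfer\<close> expects.\<close>
    have B: "B \<subseteq> {..<N}" "{..<N} - B = A" "{..<N} - insert q A = B - {q}"
      using Cons.prems(2) by (auto simp: B_def)
    from decomposes_swap[OF decomposes_apply_local[OF decomposes_transfer[OF
        decomposes_swap[OF Cons.IH[OF valid] valid(2), unfolded B(3)] B(1) q] B(1) U] B(1)]
    show ?thesis unfolding B(2) by (simp add: Bob B_def)
  qed
qed

text \<open>Letting \<open>T\<close> act on the state and the transpose of \<open>S\<close> on its
  conjugate writes the form as a sum of \<open>\<alpha> x i * \<beta> y i\<close> with complex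
  vectors of norm at most 1. Its real part is a difference of two such sums over the reals, which
  accounts for the 2.\<close>

lemma schur_bounded_local_form:
  assumes A: "A \<subseteq> {..<N}" and \<psi>: "(\<Sum>z\<in>Pow {..<N}. (cmod (\<psi> z))\<^sup>2) = 1"
    and S: "\<And>x. contraction_on A (S x)" and T: "\<And>y. contraction_on ({..<N} - A) (T y)"
  shows "schur_bounded X Y (\<lambda>x y. Re (local_form N A (S x) (T y) \<psi>)) 2"
proof -
  define B where "B = {..<N} - A"
  define \<alpha> where "\<alpha> x i = (\<Sum>s\<in>Pow A. S x s (fst i) * cnj (\<psi> (s \<union> snd i)))" for x and i :: "nat set \<times> nat set"
  define \<beta> where "\<beta> y i = (\<Sum>t\<in>Pow B. T y (snd i) t * \<psi> (fst i \<union> t))" for y and i :: "nat set \<times> nat set"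
  have norm_\<psi>: "(\<Sum>a\<in>Pow A. \<Sum>b\<in>Pow B. (cmod (\<psi> (a \<union> b)))\<^sup>2) = 1"
    using sum_Pow_split[OF A, of "\<lambda>a b. (cmod (\<psi> (a \<union> b)))\<^sup>2"] \<psi>
    by (simp add: Int_Diff_Un B_def)
  have \<alpha>: "(\<Sum>i\<in>Pow A \<times> Pow B. (cmod (\<alpha> x i))\<^sup>2) \<le> 1" for x
  proof -
    have "(\<Sum>i\<in>Pow A \<times> Pow B. (cmod (\<alpha> x i))\<^sup>2)
        = (\<Sum>b\<in>Pow B. \<Sum>a\<in>Pow A. (cmod (\<Sum>s\<in>Pow A. S x s a * cnj (\<psi> (s \<union> b))))\<^sup>2)"
      by (subst sum.swap) (simp add: \<alpha>_def sum.cartesian_product case_prod_beta)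
    also have "\<dots> \<le> (\<Sum>b\<in>Pow B. \<Sum>s\<in>Pow A. (cmod (cnj (\<psi> (s \<union> b))))\<^sup>2)"
    proof (rule sum_mono)
      fix b
      show "(\<Sum>a\<in>Pow A. (cmod (\<Sum>s\<in>Pow A. S x s a * cnj (\<psi> (s \<union> b))))\<^sup>2)
          \<le> (\<Sum>s\<in>Pow A. (cmod (cnj (\<psi> (s \<union> b))))\<^sup>2)"
        using contraction_on_transpose[OF S, of x] unfolding contraction_on_def by (rule spec)
    qed
    also have "\<dots> = 1"
      using norm_\<psi> by (subst sum.swap) simp
    finally show ?thesis .
  qed
  have \<beta>: "(\<Sum>i\<in>Pow A \<times> Pow B. (cmod (\<beta> y i))\<^sup>2) \<le> 1" for y
  proof -
    have "(\<Sum>i\<in>Pow A \<times> Pow B. (cmod (\<beta> y i))\<^sup>2)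
        = (\<Sum>a\<in>Pow A. \<Sum>b\<in>Pow B. (cmod (\<Sum>t\<in>Pow B. T y b t * \<psi> (a \<union> t)))\<^sup>2)"
      by (simp add: \<beta>_def sum.cartesian_product case_prod_beta)
    also have "\<dots> \<le> (\<Sum>a\<in>Pow A. \<Sum>t\<in>Pow B. (cmod (\<psi> (a \<union> t)))\<^sup>2)"
      using T by (intro sum_mono[where K = "Pow A"]) (simp add: contraction_on_def B_def)
    finally show ?thesis using norm_\<psi> by simp
  qed
  have form: "local_form N A (S x) (T y) \<psi> = (\<Sum>i\<in>Pow A \<times> Pow B. \<alpha> x i * \<beta> y i)" for x y
  proof -
    have "local_form N A (S x) (T y) \<psi> = (\<Sum>a\<in>Pow A. \<Sum>a'\<in>Pow A. \<Sum>b\<in>Pow B. \<Sum>b'\<in>Pow B.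
           cnj (\<psi> (a \<union> b)) * S x a a' * T y b b' * \<psi> (a' \<union> b'))"
      unfolding local_form_split[OF A] B_def by (intro sum.cong refl sum.swap)
    also have "\<dots> = (\<Sum>a'\<in>Pow A. \<Sum>a\<in>Pow A. \<Sum>b\<in>Pow B. \<Sum>b'\<in>Pow B.
           cnj (\<psi> (a \<union> b)) * S x a a' * T y b b' * \<psi> (a' \<union> b'))"
      by (rule sum.swap)
    also have "\<dots> = (\<Sum>a'\<in>Pow A. \<Sum>b\<in>Pow B. \<Sum>a\<in>Pow A. \<Sum>b'\<in>Pow B.
           cnj (\<psi> (a \<union> b)) * S x a a' * T y b b' * \<psi> (a' \<union> b'))"
      by (intro sum.cong refl sum.swap)
    also have "\<dots> = (\<Sum>a'\<in>Pow A. \<Sum>b\<in>Pow B. \<alpha> x (a', b) * \<beta> y (a', b))"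
      by (simp add: \<alpha>_def \<beta>_def sum_distrib_left sum_distrib_right mult_ac)
    finally show ?thesis by (simp add: sum.cartesian_product case_prod_beta)
  qed
  have part: "(\<Sum>i\<in>I. (h (\<gamma> i))\<^sup>2) \<le> 1"
    if "(\<Sum>i\<in>I. (cmod (\<gamma> i))\<^sup>2) \<le> 1" "\<And>z. \<bar>h z\<bar> \<le> cmod z" for h and \<gamma> :: "'i \<Rightarrow> complex" and I
    using that by (intro order_trans[OF sum_mono that(1)]) (simp add: abs_le_square_iff[symmetric])
  have "schur_bounded X Y (\<lambda>x y. (\<Sum>i\<in>Pow A \<times> Pow B. Re (\<alpha> x i) * Re (\<beta> y i))
          + (\<Sum>i\<in>Pow A \<times> Pow B. (- Im (\<alpha> x i)) * Im (\<beta> y i))) (1 + 1)"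
    by (intro schur_bounded_add schur_bounded_inner)
       (auto intro!: part[OF \<alpha>] part[OF \<beta>] abs_Re_le_cmod abs_Im_le_cmod)
  then show ?thesis
    by (simp add: form sum_subtractf sum_negf)
qed

section \<open>Conservation of norm and the acceptance probability\<close>

lemma apply_local_norm:
  assumes A: "A \<subseteq> {..<N}" and U: "unitary_on A U"
  shows "(\<Sum>z\<in>Pow {..<N}. (cmod (apply_local A U \<psi> z))\<^sup>2) = (\<Sum>z\<in>Pow {..<N}. (cmod (\<psi> z))\<^sup>2)"
proof -
  have fin: "finite A" using A finite_subset by blast
  have "(\<Sum>z\<in>Pow {..<N}. (cmod (apply_local A U \<psi> z))\<^sup>2)
      = (\<Sum>a\<in>Pow A. \<Sum>b\<in>Pow ({..<N} - A). (cmod (\<Sum>s\<in>Pow A. U a s * \<psi> (s \<union> b)))\<^sup>2)"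
    unfolding apply_local_def
    by (rule sum_Pow_split[OF A, of "\<lambda>a b. (cmod (\<Sum>s\<in>Pow A. U a s * \<psi> (s \<union> b)))\<^sup>2"])
  also have "\<dots> = (\<Sum>b\<in>Pow ({..<N} - A). \<Sum>s\<in>Pow A. (cmod (\<psi> (s \<union> b)))\<^sup>2)"
    by (subst sum.swap) (simp only: unitary_on_isometry[OF U fin])
  also have "\<dots> = (\<Sum>s\<in>Pow A. \<Sum>b\<in>Pow ({..<N} - A). (cmod (\<psi> (s \<union> b)))\<^sup>2)"
    by (rule sum.swap)
  also have "\<dots> = (\<Sum>z\<in>Pow {..<N}. (cmod (\<psi> (z \<inter> A \<union> (z - A))))\<^sup>2)"
    by (rule sum_Pow_split[OF A, symmetric])
  finally show ?thesis by (simp add: Int_Diff_Un)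
qed

lemma run_actions_norm:
  assumes "valid_actions N A as" "A \<subseteq> {..<N}"
  shows "(\<Sum>z\<in>Pow {..<N}. (cmod (run_actions N x y A as \<psi> z))\<^sup>2) = (\<Sum>z\<in>Pow {..<N}. (cmod (\<psi> z))\<^sup>2)"
  using assms
proof (induction as arbitrary: A \<psi>)
  case (Cons a as)
  show ?case
  proof (cases a)
    case (Alice U q)
    with Cons.prems have "valid_actions N (A - {q}) as" "A - {q} \<subseteq> {..<N}" "unitary_on A (U x)" by auto
    with Cons.IH Cons.prems(2) show ?thesis by (simp add: Alice apply_local_norm)
  next
    case (Bob U q)
    with Cons.prems have "valid_actions N (insert q A) as" "insert q A \<subseteq> {..<N}"
      "unitary_on ({..<N} - A) (U y)" by auto
    with Cons.IH show ?thesis by (simp add: Bob apply_local_norm)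
  qed
qed simp

lemma output_prob_nonneg: "0 \<le> output_prob P x y b"
  by (simp add: output_prob_def sum_nonneg)

text \<open>\<open>computes\<close> bounds only the probability of the wrong output; total
  probability 1 makes this a statement on the acceptance probability for either value. Unitarity of
  all actions preserves the norm of the initial state.\<close>

lemma output_prob_sum:
  assumes "valid_qprotocol P"
  shows "output_prob P x y True + output_prob P x y False = 1"
proof -
  define q where "q = selected_qubit (final_action P)"
  define \<phi> where "\<phi> = run_actions (num_qubits P) x y (alice_qubits P) (messages P @ [final_action P]) (initial_state P)"
  have "output_prob P x y True + output_prob P x y False
      = (\<Sum>z\<in>{z \<in> Pow {..<num_qubits P}. (q \<in> z) = True} \<union> {z \<in> Pow {..<num_qubits P}. (q \<in> z) = False}. (cmod (\<phi> z))\<^sup>2)"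
    unfolding output_prob_def q_def[symmetric] \<phi>_def[symmetric]
    by (rule sum.union_disjoint[symmetric]) auto
  also have "{z \<in> Pow {..<num_qubits P}. (q \<in> z) = True} \<union> {z \<in> Pow {..<num_qubits P}. (q \<in> z) = False}
      = Pow {..<num_qubits P}"
    by blast
  finally show ?thesis
    using assms run_actions_norm[of "num_qubits P" "alice_qubits P" "messages P @ [final_action P]" x y]
    by (simp add: valid_qprotocol_def \<phi>_def)
qed

lemma schur_bounded_sum_list:
  assumes "\<And>l. l \<in> set L \<Longrightarrow> schur_bounded X Y (P l) K"
  shows "schur_bounded X Y (\<lambda>x y. \<Sum>l\<leftarrow>L. P l x y) (real (length L) * K)"
  using assms
proof (induction L)
  case Nil
  then show ?case by (simp add: schur_bounded_def op_bounded_def)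
next
  case (Cons l L)
  then have "schur_bounded X Y (\<lambda>x y. P l x y + (\<Sum>l\<leftarrow>L. P l x y)) (K + real (length L) * K)"
    by (intro schur_bounded_add) auto
  then show ?case by (simp add: algebra_simps)
qed

lemma schur_bounded_output_prob:
  assumes "valid_qprotocol P"
  shows "schur_bounded X Y (\<lambda>x y. output_prob P x y b) (2 * 4 ^ length (messages P))"
proof -
  define A where "A = alice_qubits P"
  define N where "N = num_qubits P"
  have valid: "valid_actions N A (messages P @ [final_action P])" "A \<subseteq> {..<N}"
    and \<psi>: "(\<Sum>z\<in>Pow {..<N}. (cmod (initial_state P z))\<^sup>2) = 1"
    using assms by (auto simp: valid_qprotocol_def A_def N_def)
  obtain L where L: "length L = 4 ^ length (messages P)"
    "\<forall>(S, T)\<in>set L. (\<forall>x. contraction_on A (S x)) \<and> (\<forall>y. contraction_on ({..<N} - A) (T y))"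
    "\<forall>x y \<psi>. of_real (\<Sum>z \<in> {z \<in> Pow {..<N}. (selected_qubit (final_action P) \<in> z) = b}.
        (cmod (run_actions N x y A (messages P @ [final_action P]) \<psi> z))\<^sup>2)
      = (\<Sum>(S, T)\<leftarrow>L. local_form N A (S x) (T y) \<psi>)"
    using decomposes_run_actions[OF valid, of b] unfolding decomposes_def by auto
  have "complex_of_real (output_prob P x y b) = (\<Sum>(S, T)\<leftarrow>L. local_form N A (S x) (T y) (initial_state P))" for x y
    using L(3) unfolding output_prob_def A_def N_def by blast
  then have "output_prob P x y b = Re (\<Sum>(S, T)\<leftarrow>L. local_form N A (S x) (T y) (initial_state P))" for x y
    by (metis Re_complex_of_real)
  moreover have "Re (\<Sum>l\<leftarrow>L'. h l) = (\<Sum>l\<leftarrow>L'. Re (h l))" for h and L' :: "'l list"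
    by (induction L') auto
  ultimately have out: "output_prob P x y b
      = (\<Sum>l\<leftarrow>L. Re (local_form N A (fst l x) (snd l y) (initial_state P)))" for x y
    by (simp add: case_prod_unfold)
  have "schur_bounded X Y (\<lambda>x y. \<Sum>l\<leftarrow>L. Re (local_form N A (fst l x) (snd l y) (initial_state P)))
      (real (length L) * 2)"
    using L(2) by (intro schur_bounded_sum_list schur_bounded_local_form valid \<psi>) auto
  then show ?thesis by (simp add: out L(1) mult.commute)
qed

section \<open>Approximation by low-degree Fourier expansions\<close>

text \<open>An upper bound in place of an exact degree makes the class closed under addition, where
  leading terms may cancel.\<close>

definition low_degree :: "nat \<Rightarrow> nat \<Rightarrow> (bool list \<Rightarrow> real) \<Rightarrow> bool" where
  "low_degree n D h \<longleftrightarrow> (\<exists>p. in_variables n p \<and> total_degree p \<le> D \<and>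
     (\<forall>x\<in>bits n. mpoly_eval p (\<lambda>i. of_bool (x ! i)) = h x))"

lemma mpoly_eval_superset:
  assumes "finite T" "Poly_Mapping.keys p \<subseteq> T"
  shows "mpoly_eval p v = (\<Sum>m\<in>T. Poly_Mapping.lookup p m *
           (\<Prod>i\<in>Poly_Mapping.keys m. v i ^ Poly_Mapping.lookup m i))"
  unfolding mpoly_eval_def using assms
  by (intro sum.mono_neutral_left) (auto simp: not_in_keys_iff_lookup_eq_zero)

lemma mpoly_eval_add: "mpoly_eval (p + q) v = mpoly_eval p v + mpoly_eval q v"
proof -
  define T where "T = Poly_Mapping.keys p \<union> Poly_Mapping.keys q"
  have T: "finite T" "Poly_Mapping.keys p \<subseteq> T" "Poly_Mapping.keys q \<subseteq> T" "Poly_Mapping.keys (p + q) \<subseteq> T"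
    using keys_add[of p q] by (auto simp: T_def)
  show ?thesis
    unfolding mpoly_eval_superset[OF T(1,2)] mpoly_eval_superset[OF T(1,3)] mpoly_eval_superset[OF T(1,4)]
    by (simp add: lookup_add distrib_right sum.distrib)
qed

lemma total_degree_le_iff:
  "total_degree p \<le> D \<longleftrightarrow>
     (\<forall>m\<in>Poly_Mapping.keys p. (\<Sum>i\<in>Poly_Mapping.keys m. Poly_Mapping.lookup m i) \<le> D)"
  unfolding total_degree_def by (subst Max_le_iff) auto

lemma low_degree_add:
  assumes "low_degree n D h" "low_degree n D h'"
  shows "low_degree n D (\<lambda>x. h x + h' x)"
proof -
  obtain p q where "in_variables n p" "total_degree p \<le> D"
      "\<forall>x\<in>bits n. mpoly_eval p (\<lambda>i. of_bool (x ! i)) = h x"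
    and "in_variables n q" "total_degree q \<le> D"
      "\<forall>x\<in>bits n. mpoly_eval q (\<lambda>i. of_bool (x ! i)) = h' x"
    using assms unfolding low_degree_def by blast
  then show ?thesis
    unfolding low_degree_def total_degree_le_iff in_variables_def
    using keys_add[of p q] by (intro exI[of _ "p + q"]) (simp add: mpoly_eval_add subset_eq Un_iff, metis)
qed

lemma low_degree_0: "low_degree n D (\<lambda>x. 0)"
  unfolding low_degree_def total_degree_le_iff in_variables_def
  by (intro exI[of _ 0]) (simp add: mpoly_eval_def)

lemma low_degree_sum:
  assumes "\<And>s. s \<in> T \<Longrightarrow> low_degree n D (h s)"
  shows "low_degree n D (\<lambda>x. \<Sum>s\<in>T. h s x)"
  using assms
  by (induction T rule: infinite_finite_induct) (auto intro: low_degree_0 low_degree_add)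

lemma low_degree_monomial:
  assumes "S \<subseteq> {..<n}" "card S \<le> D"
  shows "low_degree n D (\<lambda>x. c * (\<Prod>i\<in>S. of_bool (x ! i)))"
proof -
  define m :: "nat \<Rightarrow>\<^sub>0 nat" where "m = Abs_poly_mapping (\<lambda>i. of_bool (i \<in> S))"
  have "finite S" using assms(1) finite_subset by blast
  then have lookup_m: "Poly_Mapping.lookup m = (\<lambda>i. of_bool (i \<in> S))"
    by (simp add: m_def)
  then have keys_m: "Poly_Mapping.keys m = S"
    by (auto simp: in_keys_iff)
  show ?thesis
    unfolding low_degree_def total_degree_le_iff in_variables_def
    using assms
    by (intro exI[of _ "Poly_Mapping.single m c"])
       (auto simp: mpoly_eval_def keys_m lookup_m)
qed

definition bit_sign :: "bool \<Rightarrow> real" where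
  "bit_sign b = (if b then -1 else 1)"

text \<open>The sign of a bit is 1 minus twice the bit, so a character on \<open>S\<close> expands
  into monomials on subsets of \<open>S\<close>.\<close>

lemma low_degree_character:
  assumes "S \<subseteq> {..<n}" "card S \<le> D"
  shows "low_degree n D (\<lambda>x. c * (\<Prod>i\<in>S. bit_sign (x ! i)))"
proof -
  have fin: "finite S" using assms(1) finite_subset by blast
  have "c * (\<Prod>i\<in>S. bit_sign (x ! i))
      = (\<Sum>R\<in>Pow S. c * (-2) ^ card R * (\<Prod>i\<in>R. of_bool (x ! i)))" for x
  proof -
    have "(\<Prod>i\<in>S. bit_sign (x ! i)) = (\<Prod>i\<in>S. -2 * of_bool (x ! i) + 1)"
      by (intro prod.cong) (auto simp: bit_sign_def)
    also have "\<dots> = (\<Sum>R\<in>Pow S. (\<Prod>i\<in>R. -2 * of_bool (x ! i)))"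
      by (subst prod_add[OF fin]) simp
    finally show ?thesis
      by (simp only: prod.distrib prod_constant sum_distrib_left mult.assoc)
  qed
  moreover have "low_degree n D (\<lambda>x. \<Sum>R\<in>Pow S. c * (-2) ^ card R * (\<Prod>i\<in>R. of_bool (x ! i)))"
    using assms card_mono[OF fin]
    by (intro low_degree_sum low_degree_monomial) (auto intro: order_trans)
  ultimately show ?thesis by simp
qed

lemma approx_degree_le:
  assumes "low_degree n D h" "\<And>x. x \<in> bits n \<Longrightarrow> \<bar>of_bool (f x) - h x\<bar> \<le> 1 / 3"
  shows "approx_degree n f \<le> D"
proof -
  obtain p where "in_variables n p" "total_degree p \<le> D"
      "\<forall>x\<in>bits n. mpoly_eval p (\<lambda>i. of_bool (x ! i)) = h x"
    using assms(1) unfolding low_degree_def by blast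
  then have "approx_degree n f \<le> total_degree p"
    unfolding approx_degree_def using assms(2) by (intro Least_le exI[of _ p]) auto
  then show ?thesis using \<open>total_degree p \<le> D\<close> by simp
qed

lemma finite_bits: "finite (bits n)"
  unfolding bits_def using finite_lists_length_eq[of "UNIV :: bool set" n] by simp

text \<open>Fourier inversion represents \<open>f\<close> exactly. The bound serves to get
  \<open>r < 1\<close> from \<open>r < d / (5 * n)\<close>.\<close>

lemma approx_degree_le_arity: "approx_degree n f \<le> n"
proof (rule approx_degree_le)
  define w where "w S y = of_bool (f y) * (1/2) ^ n * (\<Prod>i\<in>S. bit_sign (y ! i))" for S y
  show "low_degree n n (\<lambda>x. \<Sum>y\<in>bits n. \<Sum>S\<in>Pow {..<n}. w S y * (\<Prod>i\<in>S. bit_sign (x ! i)))"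
    using card_mono[of "{..<n}"] by (intro low_degree_sum low_degree_character) auto
  fix x assume x: "x \<in> bits n"
  have "(\<Sum>S\<in>Pow {..<n}. w S y * (\<Prod>i\<in>S. bit_sign (x ! i))) = (if y = x then of_bool (f y) else 0)"
    if y: "y \<in> bits n" for y
  proof -
    have "(\<Sum>S\<in>Pow {..<n}. w S y * (\<Prod>i\<in>S. bit_sign (x ! i)))
        = of_bool (f y) * (1/2) ^ n * (\<Sum>S\<in>Pow {..<n}. \<Prod>i\<in>S. bit_sign (y ! i) * bit_sign (x ! i))"
      by (simp add: w_def sum_distrib_left prod.distrib mult.assoc)
    also have "(\<Sum>S\<in>Pow {..<n}. \<Prod>i\<in>S. bit_sign (y ! i) * bit_sign (x ! i))
        = (\<Prod>i<n. bit_sign (y ! i) * bit_sign (x ! i) + 1)"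
      by (subst prod_add) simp_all
    \<comment> \<open>A factor is 2 where the bits agree and 0 where they differ; the product
      detects \<open>y = x\<close>.\<close>
    also have "(\<Prod>i<n. bit_sign (y ! i) * bit_sign (x ! i) + 1) = (\<Prod>i<n. 2 * of_bool (x ! i = y ! i))"
      by (intro prod.cong) (auto simp: bit_sign_def)
    also have "\<dots> = 2 ^ n * of_bool (y = x)"
      using x y by (cases "y = x") (auto simp: bits_def list_eq_iff_nth_eq)
    finally show ?thesis by (simp add: power_one_over)
  qed
  then show "\<bar>of_bool (f x) -
      (\<Sum>y\<in>bits n. \<Sum>S\<in>Pow {..<n}. w S y * (\<Prod>i\<in>S. bit_sign (x ! i)))\<bar> \<le> 1/3"
    using x by (simp add: finite_bits)
qed

text \<open>An exponential-moment bound: each term is enlarged by \<open>4 ^ (card S - D)\<close>,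
  the sum is extended to all subsets, and expanding the \<open>n\<close>-th power of
  \<open>4 * r + (1 + r)\<close> evaluates it.\<close>

lemma sum_Pow_tail_le:
  fixes r :: real
  assumes "0 \<le> r"
  shows "(\<Sum>S | S \<subseteq> {..<n} \<and> D \<le> card S. \<Prod>i<n. if i \<in> S then r else 1 + r) \<le> (1 + 5 * r) ^ n / 4 ^ D"
proof -
  have split: "(\<Prod>i<n. if i \<in> S then a else b) = a ^ card S * b ^ card ({..<n} - S)"
    if "S \<subseteq> {..<n}" for S and a b :: real
  proof -
    have "{..<n} \<inter> S = S" using that by blast
    then show ?thesis by (simp add: prod.If_cases Diff_eq)
  qed
  have "(\<Sum>S | S \<subseteq> {..<n} \<and> D \<le> card S. \<Prod>i<n. if i \<in> S then r else 1 + r)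
      \<le> (\<Sum>S | S \<subseteq> {..<n} \<and> D \<le> card S. (4 * r) ^ card S * (1 + r) ^ card ({..<n} - S) / 4 ^ D)"
  proof (intro sum_mono)
    fix S assume "S \<in> {S. S \<subseteq> {..<n} \<and> D \<le> card S}"
    then have S: "S \<subseteq> {..<n}" "(4::real) ^ D \<le> 4 ^ card S" by (auto intro: power_increasing)
    have "r ^ card S * (1 + r) ^ card ({..<n} - S) * 4 ^ D
        \<le> r ^ card S * (1 + r) ^ card ({..<n} - S) * 4 ^ card S"
      using S assms by (intro mult_left_mono) auto
    then show "(\<Prod>i<n. if i \<in> S then r else 1 + r)
        \<le> (4 * r) ^ card S * (1 + r) ^ card ({..<n} - S) / 4 ^ D"
      unfolding split[OF S(1)] by (simp add: field_simps power_mult_distrib)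
  qed
  also have "\<dots> \<le> (\<Sum>S\<in>Pow {..<n}. (4 * r) ^ card S * (1 + r) ^ card ({..<n} - S) / 4 ^ D)"
    using assms by (intro sum_mono2) auto
  also have "\<dots> = (\<Prod>i<n. 4 * r + (1 + r)) / 4 ^ D"
    by (subst prod_add) (simp_all add: sum_divide_distrib)
  finally show ?thesis by (simp add: algebra_simps)
qed

text \<open>The protocol enters only through \<open>Q\<close>: its Schur bound controls the Fourier
  coefficients of the average, and \<open>close\<close> says what is approximated. If the tail from
  degree \<open>D\<close> on fits into the remaining error, the part below \<open>D\<close> is
  itself an admissible approximation.\<close>

lemma approx_degree_less:
  fixes m :: "bool \<Rightarrow> bool list \<Rightarrow> bool list \<Rightarrow> real"
  assumes len: "\<forall>a\<in>I. length a = k" "\<forall>b\<in>J. length b = k"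
    and s: "s = sqrt (real (card I) * real (card J))" "s > 0"
    and plus: "op_bounded I J (\<lambda>a b. (m False a b + m True a b) / 2) ((1 + r) / s)"
    and minus: "op_bounded I J (\<lambda>a b. (m False a b - m True a b) / 2) (r / s)"
    and Q: "schur_bounded (blocks_in k n I) (blocks_in k n J) Q K"
    and close: "\<And>z. z \<in> bits n \<Longrightarrow> \<bar>of_bool (f z) - (\<Sum>x\<in>blocks_in k n I. \<Sum>y\<in>blocks_in k n J.
                  (\<Prod>i<n. m (z ! i) (block k x i) (block k y i)) * Q x y)\<bar> \<le> \<epsilon>"
    and small: "\<epsilon> + K * ((1 + 5 * r) ^ n / 4 ^ D) \<le> 1 / 3"
    and D: "D \<ge> 1"
  shows "approx_degree n f < D"
proof -
  define X where "X = blocks_in k n I"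
  define Y where "Y = blocks_in k n J"
  define d where "d t a b = (if t then (m False a b - m True a b) / 2 else (m False a b + m True a b) / 2)"
    for t a b
  define T where "T S x y = (\<Prod>i<n. d (i \<in> S) (block k x i) (block k y i))" for S x y
  define e where "e S = (\<Sum>x\<in>X. \<Sum>y\<in>Y. T S x y * Q x y)" for S
  define walsh where "walsh S z = (\<Prod>i\<in>S. bit_sign (z ! i))" for S z
  have r: "0 \<le> r" and K: "0 \<le> K"
    using minus s Q by (auto simp: op_bounded_def schur_bounded_def zero_le_divide_iff)
  have expand: "(\<Prod>i<n. m (z ! i) (block k x i) (block k y i)) = (\<Sum>S\<in>Pow {..<n}. walsh S z * T S x y)" for x y z
  proof -
    have "m b a c = bit_sign b * d True a c + d False a c" for b a c
      by (cases b) (simp_all add: bit_sign_def d_def field_simps)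
    then have "(\<Prod>i<n. m (z ! i) (block k x i) (block k y i))
        = (\<Sum>S\<in>Pow {..<n}. (\<Prod>i\<in>S. bit_sign (z ! i) * d True (block k x i) (block k y i))
             * (\<Prod>i\<in>{..<n} - S. d False (block k x i) (block k y i)))"
      by (simp add: prod_add)
    also have "\<dots> = (\<Sum>S\<in>Pow {..<n}. walsh S z * T S x y)"
    proof (intro sum.cong refl)
      fix S assume "S \<in> Pow {..<n}"
      then have "T S x y = (\<Prod>i\<in>{..<n} - S. d (i \<in> S) (block k x i) (block k y i))
                         * (\<Prod>i\<in>S. d (i \<in> S) (block k x i) (block k y i))"
        unfolding T_def by (intro prod.subset_diff) auto
      then show "(\<Prod>i\<in>S. bit_sign (z ! i) * d True (block k x i) (block k y i))
             * (\<Prod>i\<in>{..<n} - S. d False (block k x i) (block k y i)) = walsh S z * T S x y"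
        by (simp add: prod.distrib walsh_def)
    qed
    finally show ?thesis .
  qed
  have fourier: "(\<Sum>x\<in>X. \<Sum>y\<in>Y. (\<Prod>i<n. m (z ! i) (block k x i) (block k y i)) * Q x y)
      = (\<Sum>S\<in>Pow {..<n}. e S * walsh S z)" for z
  proof -
    have "(\<Sum>x\<in>X. \<Sum>y\<in>Y. (\<Prod>i<n. m (z ! i) (block k x i) (block k y i)) * Q x y)
        = (\<Sum>x\<in>X. \<Sum>y\<in>Y. \<Sum>S\<in>Pow {..<n}. walsh S z * (T S x y * Q x y))"
      unfolding expand sum_distrib_right by (simp only: mult.assoc)
    also have "\<dots> = (\<Sum>x\<in>X. \<Sum>S\<in>Pow {..<n}. \<Sum>y\<in>Y. walsh S z * (T S x y * Q x y))"
      by (intro sum.cong refl sum.swap)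
    also have "\<dots> = (\<Sum>S\<in>Pow {..<n}. \<Sum>x\<in>X. \<Sum>y\<in>Y. walsh S z * (T S x y * Q x y))"
      by (rule sum.swap)
    finally show ?thesis by (simp add: e_def sum_distrib_left sum_distrib_right mult_ac)
  qed
  have e_le: "\<bar>e S\<bar> \<le> K * (\<Prod>i<n. if i \<in> S then r else 1 + r)" for S
  proof -
    have "op_bounded X Y (T S) (\<Prod>i<n. (if i \<in> S then r else 1 + r) / s)"
      unfolding X_def Y_def T_def using plus minus
      by (intro op_bounded_blocks len) (auto simp: d_def)
    then have "op_bounded X Y (\<lambda>x y. T S x y * Q x y) (K * (\<Prod>i<n. (if i \<in> S then r else 1 + r) / s))"
      using Q by (simp add: schur_bounded_def X_def Y_def)
    \<comment> \<open>A coefficient is the bilinear form at all-ones vectors; their norms multiply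
      to \<open>s ^ n\<close> and cancel the \<open>n\<close> factors \<open>1 / s\<close>.\<close>
    from op_bounded_le[OF this, of "\<lambda>_. 1" "\<lambda>_. 1"]
    have "\<bar>e S\<bar> \<le> K * (\<Prod>i<n. (if i \<in> S then r else 1 + r) / s) * (L2_set (\<lambda>_. 1) X * L2_set (\<lambda>_. 1) Y)"
      by (simp add: e_def)
    also have "L2_set (\<lambda>_. 1) X * L2_set (\<lambda>_. 1) Y = s ^ n"
      unfolding L2_set_def X_def Y_def
      by (simp add: card_blocks_in[OF len(1)] card_blocks_in[OF len(2)] s(1)
          real_sqrt_mult real_sqrt_power power_mult_distrib)
    also have "K * (\<Prod>i<n. (if i \<in> S then r else 1 + r) / s) * s ^ n
        = K * (\<Prod>i<n. if i \<in> S then r else 1 + r)"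
      using s(2) by (simp add: prod_dividef)
    finally show ?thesis .
  qed
  define low where "low = {S. S \<subseteq> {..<n} \<and> card S < D}"
  define high where "high = {S. S \<subseteq> {..<n} \<and> D \<le> card S}"
  have Pow: "Pow {..<n} = low \<union> high" "low \<inter> high = {}" "finite low" "finite high"
    by (auto simp: low_def high_def)
  \<comment> \<open>The sets in \<open>low\<close> have at most \<open>D - 1\<close> elements;
    \<open>D \<ge> 1\<close> keeps the truncated subtraction from losing strictness.\<close>
  have "approx_degree n f \<le> D - 1"
  proof (rule approx_degree_le)
    show "low_degree n (D - 1) (\<lambda>z. \<Sum>S\<in>low. e S * walsh S z)"
      unfolding walsh_def by (intro low_degree_sum low_degree_character) (auto simp: low_def)
    fix z assume z: "z \<in> bits n"
    have "\<bar>\<Sum>S\<in>high. e S * walsh S z\<bar> \<le> (\<Sum>S\<in>high. K * (\<Prod>i<n. if i \<in> S then r else 1 + r))"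
    proof (intro order_trans[OF sum_abs] sum_mono)
      fix S
      have "\<bar>walsh S z\<bar> = 1"
        unfolding walsh_def abs_prod by (intro prod.neutral) (auto simp: bit_sign_def)
      then show "\<bar>e S * walsh S z\<bar> \<le> K * (\<Prod>i<n. if i \<in> S then r else 1 + r)"
        using e_le by (simp add: abs_mult)
    qed
    also have "\<dots> \<le> K * ((1 + 5 * r) ^ n / 4 ^ D)"
      unfolding sum_distrib_left[symmetric] high_def
      by (intro mult_left_mono sum_Pow_tail_le r K)
    finally have "\<bar>\<Sum>S\<in>high. e S * walsh S z\<bar> \<le> K * ((1 + 5 * r) ^ n / 4 ^ D)" .
    moreover have "\<bar>of_bool (f z) - ((\<Sum>S\<in>low. e S * walsh S z) + (\<Sum>S\<in>high. e S * walsh S z))\<bar> \<le> \<epsilon>"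
      using close[OF z] unfolding X_def[symmetric] Y_def[symmetric] fourier
      unfolding Pow(1) sum.union_disjoint[OF Pow(3,4,2)] .
    ultimately show "\<bar>of_bool (f z) - (\<Sum>S\<in>low. e S * walsh S z)\<bar> \<le> 1 / 3"
      using small by linarith
  qed
  then show ?thesis using D by simp
qed

section \<open>Block composition\<close>

text \<open>The support of a distribution is nonempty, hence so are \<open>I\<close> and
  \<open>J\<close>; this permits division by the normalization.\<close>

lemma sqrt_card_pos:
  assumes "I \<subseteq> bits k" "J \<subseteq> bits k" "set_pmf \<mu> \<subseteq> I \<times> J"
  shows "0 < sqrt (real (card I) * real (card J))"
proof -
  obtain a b where "(a, b) \<in> set_pmf \<mu>"
    using set_pmf_not_empty[of \<mu>] by fastforce
  then have "finite I" "finite J" "I \<noteq> {}" "J \<noteq> {}"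
    using assms by (auto intro: finite_subset[OF _ finite_bits])
  then show ?thesis by (simp add: card_gt_0_iff)
qed

lemma sum_sum_pmf:
  assumes "finite I" "finite J" "set_pmf \<mu> \<subseteq> I \<times> J"
  shows "(\<Sum>a\<in>I. \<Sum>b\<in>J. pmf \<mu> (a, b)) = 1"
  using sum_pmf_eq_1[of "I \<times> J" \<mu>] assms by (simp add: sum.cartesian_product)

text \<open>Where \<open>g\<close> is a product of signs, these signs turn the difference of the two
  distributions into their sum. The bilinear form then equals the full mass 1, while the norms of
  the sign vectors multiply to \<open>s\<close>.\<close>

lemma discrepancy_ge_1:
  assumes fin: "finite I" "finite J" and s: "s = sqrt (real (card I) * real (card J))" "0 < s"
    and \<mu>: "is_b_distribution g I J False \<mu>\<^sub>0" "is_b_distribution g I J True \<mu>\<^sub>1"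
    and bound: "op_bounded I J (\<lambda>a b. (pmf \<mu>\<^sub>0 (a, b) - pmf \<mu>\<^sub>1 (a, b)) / 2) (r / s)"
    and uv: "\<And>a. \<bar>u a\<bar> = 1" "\<And>b. \<bar>v b\<bar> = 1"
    and g: "\<And>a b c. a \<in> I \<Longrightarrow> b \<in> J \<Longrightarrow> g (a, b) = Some c \<Longrightarrow> u a * v b = (if c then -1 else 1 :: real)"
  shows "1 \<le> r"
proof -
  have supp: "set_pmf \<mu>\<^sub>0 \<subseteq> I \<times> J" "set_pmf \<mu>\<^sub>1 \<subseteq> I \<times> J"
    using \<mu> by (auto simp: is_b_distribution_def)
  have "u a * ((pmf \<mu>\<^sub>0 (a, b) - pmf \<mu>\<^sub>1 (a, b)) / 2) * v b = (pmf \<mu>\<^sub>0 (a, b) + pmf \<mu>\<^sub>1 (a, b)) / 2"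
    if "a \<in> I" "b \<in> J" for a b
  proof -
    have "u a * v b * pmf \<mu>\<^sub>0 (a, b) = pmf \<mu>\<^sub>0 (a, b)"
      using g[OF that, of False] \<mu>(1) by (cases "(a, b) \<in> set_pmf \<mu>\<^sub>0") (auto simp: is_b_distribution_def set_pmf_iff)
    moreover have "u a * v b * pmf \<mu>\<^sub>1 (a, b) = - pmf \<mu>\<^sub>1 (a, b)"
      using g[OF that, of True] \<mu>(2) by (cases "(a, b) \<in> set_pmf \<mu>\<^sub>1") (auto simp: is_b_distribution_def set_pmf_iff)
    moreover have "u a * ((pmf \<mu>\<^sub>0 (a, b) - pmf \<mu>\<^sub>1 (a, b)) / 2) * v b
        = (u a * v b * pmf \<mu>\<^sub>0 (a, b) - u a * v b * pmf \<mu>\<^sub>1 (a, b)) / 2"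
      by (simp add: field_simps)
    ultimately show ?thesis by simp
  qed
  then have "(\<Sum>a\<in>I. \<Sum>b\<in>J. u a * ((pmf \<mu>\<^sub>0 (a, b) - pmf \<mu>\<^sub>1 (a, b)) / 2) * v b)
      = (\<Sum>a\<in>I. \<Sum>b\<in>J. (pmf \<mu>\<^sub>0 (a, b) + pmf \<mu>\<^sub>1 (a, b)) / 2)"
    by simp
  also have "\<dots> = 1"
    using sum_sum_pmf[OF fin supp(1)] sum_sum_pmf[OF fin supp(2)]
    by (simp add: sum_divide_distrib[symmetric] sum.distrib)
  finally have "1 \<le> r / s * (L2_set u I * L2_set v J)"
    using op_bounded_le[OF bound, of u v] by simp
  also have "L2_set u I * L2_set v J = s"
  proof -
    have "(u a)\<^sup>2 = 1" "(v b)\<^sup>2 = 1" for a b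
      using uv by (metis power2_abs one_power2)+
    then show ?thesis by (simp add: L2_set_def s(1) real_sqrt_mult)
  qed
  finally show ?thesis using s(2) by simp
qed

lemma block_concat:
  assumes "\<And>i. i < n \<Longrightarrow> length (h i) = k" "i < n"
  shows "length (concat (map h [0..<n])) = n * k" "block k (concat (map h [0..<n])) i = h i"
  using assms
proof (induction n arbitrary: i)
  case (Suc n)
  {
    case 1
    \<comment> \<open>An empty prefix offers no index for the induction hypothesis, hence the case
      split on \<open>n\<close>.\<close>
    then show ?case using Suc(1)[of 0] by (cases n) auto
  next
    case 2
    have len: "length (concat (map h [0..<n])) = n * k"
      using Suc(1)[of 0] 2 by (cases n) auto
    show ?case
    proof (cases "i = n")
      case True
      then show ?thesis using block_append_last[OF len] 2 by simp
    next
      case False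
      then show ?thesis using block_append[OF len, of i "h n"] Suc(2)[of i] 2 by simp
    qed
  }
qed auto

lemma block_compose_concat:
  assumes len: "\<And>i. length (p i) = k" "\<And>i. length (q i) = k"
    and z: "z \<in> bits n" "n \<ge> 1" and g: "\<And>i. i < n \<Longrightarrow> g (p i, q i) = Some (z ! i)"
  shows "block_compose n k f g (concat (map p [0..<n]), concat (map q [0..<n])) = Some (f z)"
proof -
  have "map (\<lambda>i. z ! i) [0..<n] = z"
    using z by (simp add: bits_def list_eq_iff_nth_eq)
  moreover have "map (\<lambda>i. the (g (block k (concat (map p [0..<n])) i, block k (concat (map q [0..<n])) i))) [0..<n]
      = map (\<lambda>i. z ! i) [0..<n]"
    using g by (simp add: block_concat len)
  ultimately show ?thesis
    using z g block_concat(1)[of n p k 0] block_concat(1)[of n q k 0]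
    by (auto simp: block_compose_def bits_def block_concat len dom_def)
qed

lemma approx_degree_constant:
  assumes "\<And>z. z \<in> bits n \<Longrightarrow> f z = c"
  shows "approx_degree n f = 0"
proof -
  have "low_degree n 0 (\<lambda>x. of_bool c * (\<Prod>i\<in>{}. of_bool (x ! i)))"
    by (rule low_degree_monomial) auto
  then have "approx_degree n f \<le> 0"
    using assms by (intro approx_degree_le[of n 0 "\<lambda>x. of_bool c"]) auto
  then show ?thesis by simp
qed

text \<open>If \<open>g\<close> were determined by one input, the signs of that input would witness \<open>r \<ge> 1\<close>. So some \<open>x\<close>
  admits partners with both values of \<open>g\<close>, and repeating \<open>x\<close> in all blocks leaves \<open>z\<close> to the other
  player alone.\<close>
lemma approx_degree_eq_0_if_one_sided:
  assumes k: "n \<ge> 1" "dom g \<subseteq> bits k \<times> bits k"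
    and I: "I \<subseteq> bits k" "J \<subseteq> bits k" and s: "s = sqrt (real (card I) * real (card J))" "0 < s"
    and \<mu>: "is_b_distribution g I J False \<mu>\<^sub>0" "is_b_distribution g I J True \<mu>\<^sub>1"
    and bound: "op_bounded I J (\<lambda>a b. (pmf \<mu>\<^sub>0 (a, b) - pmf \<mu>\<^sub>1 (a, b)) / 2) (r / s)" and r: "r < 1"
    and one_sided: "(\<forall>x y b. block_compose n k f g (x, y) = Some b \<longrightarrow> b = \<phi> x) \<or>
                    (\<forall>x y b. block_compose n k f g (x, y) = Some b \<longrightarrow> b = \<phi> y)"
  shows "approx_degree n f = 0"
proof -
  have fin: "finite I" "finite J" using I by (blast intro: finite_subset[OF _ finite_bits])+
  have ge_1: "1 \<le> r"
    if "\<And>a. \<bar>u a\<bar> = 1" "\<And>b. \<bar>v b\<bar> = 1"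
      "\<And>a b c. a \<in> I \<Longrightarrow> b \<in> J \<Longrightarrow> g (a, b) = Some c \<Longrightarrow> u a * v b = (if c then -1 else 1 :: real)" for u v
    using that by (intro discrepancy_ge_1[OF fin s \<mu> bound, of u v]) auto
  from one_sided show ?thesis
  proof
    assume \<phi>: "\<forall>x y b. block_compose n k f g (x, y) = Some b \<longrightarrow> b = \<phi> x"
    have "\<exists>x y\<^sub>0 y\<^sub>1. g (x, y\<^sub>0) = Some False \<and> g (x, y\<^sub>1) = Some True"
    proof (rule ccontr)
      assume neg: "\<not> ?thesis"
      have "1 \<le> r"
      proof (rule ge_1[of "\<lambda>a. if \<exists>b. g (a, b) = Some True then -1 else 1" "\<lambda>_. 1"])
        fix a b c assume "g (a, b) = Some c"
        then show "(if \<exists>b. g (a, b) = Some True then -1 else 1) * 1 = (if c then -1 else 1 :: real)"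
          using neg by (cases c) auto
      qed auto
      then show False using r by simp
    qed
    then obtain x y\<^sub>0 y\<^sub>1 where g: "g (x, y\<^sub>0) = Some False" "g (x, y\<^sub>1) = Some True" by blast
    then have len: "length x = k" "length y\<^sub>0 = k" "length y\<^sub>1 = k"
      using k(2) by (auto simp: bits_def dom_def)
    have "f z = \<phi> (concat (map (\<lambda>_. x) [0..<n]))" if z: "z \<in> bits n" for z
    proof -
      have "block_compose n k f g (concat (map (\<lambda>_. x) [0..<n]),
          concat (map (\<lambda>i. if z ! i then y\<^sub>1 else y\<^sub>0) [0..<n])) = Some (f z)"
        by (rule block_compose_concat) (use z k(1) g len in auto)
      then show ?thesis using \<phi> by blast
    qed
    then show ?thesis by (rule approx_degree_constant)
  next
    assume \<phi>: "\<forall>x y b. block_compose n k f g (x, y) = Some b \<longrightarrow> b = \<phi> y"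
    have "\<exists>y x\<^sub>0 x\<^sub>1. g (x\<^sub>0, y) = Some False \<and> g (x\<^sub>1, y) = Some True"
    proof (rule ccontr)
      assume neg: "\<not> ?thesis"
      have "1 \<le> r"
      proof (rule ge_1[of "\<lambda>_. 1" "\<lambda>b. if \<exists>a. g (a, b) = Some True then -1 else 1"])
        fix a b c assume "g (a, b) = Some c"
        then show "1 * (if \<exists>a. g (a, b) = Some True then -1 else 1) = (if c then -1 else 1 :: real)"
          using neg by (cases c) auto
      qed auto
      then show False using r by simp
    qed
    then obtain y x\<^sub>0 x\<^sub>1 where g: "g (x\<^sub>0, y) = Some False" "g (x\<^sub>1, y) = Some True" by blast
    then have len: "length y = k" "length x\<^sub>0 = k" "length x\<^sub>1 = k"
      using k(2) by (auto simp: bits_def dom_def)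
    have "f z = \<phi> (concat (map (\<lambda>_. y) [0..<n]))" if z: "z \<in> bits n" for z
    proof -
      have "block_compose n k f g (concat (map (\<lambda>i. if z ! i then x\<^sub>1 else x\<^sub>0) [0..<n]),
          concat (map (\<lambda>_. y) [0..<n])) = Some (f z)"
        by (rule block_compose_concat) (use z k(1) g len in auto)
      then show ?thesis using \<phi> by blast
    qed
    then show ?thesis by (rule approx_degree_constant)
  qed
qed

text \<open>The polynomial \<open>3p\<^sup>2 - 2p\<^sup>3\<close> is the success probability of a majority vote over three runs; applied to
  the acceptance probabilities it leaves a gap between the error and \<open>1/3\<close>.\<close>
lemma computes_acceptance:
  assumes "valid_qprotocol P" "computes P F" "F (x, y) = Some b"
  defines "p \<equiv> output_prob P x y True"
  shows "b = (p > 1 / 2)" "\<bar>of_bool b - (3 * p\<^sup>2 - 2 * p ^ 3)\<bar> \<le> 7 / 27"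
proof -
  have p: "0 \<le> p" "0 \<le> 1 - p"
    using output_prob_sum[OF assms(1), of x y] output_prob_nonneg[of P x y]
    by (auto simp: p_def algebra_simps) (metis add_le_same_cancel1 add.commute le_add_same_cancel1 output_prob_nonneg)
  \<comment> \<open>7/27 is the value at \<open>t = 1/3\<close>, and the polynomial increases up to
    there.\<close>
  have amplify: "0 \<le> 3 * t\<^sup>2 - 2 * t ^ 3" "3 * t\<^sup>2 - 2 * t ^ 3 \<le> 7 / 27" if "0 \<le> t" "t \<le> 1 / 3" for t :: real
  proof -
    have "3 * t\<^sup>2 - 2 * t ^ 3 = t\<^sup>2 * (3 - 2 * t)" by (simp add: power2_eq_square power3_eq_cube algebra_simps)
    then show "0 \<le> 3 * t\<^sup>2 - 2 * t ^ 3" using that by simp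
    have "7 / 27 - (3 * t\<^sup>2 - 2 * t ^ 3) = (1 / 3 - t) * (7 / 9 + t * (7 / 3 - 2 * t))"
      by (simp add: power2_eq_square power3_eq_cube field_simps)
    also have "\<dots> \<ge> 0" using that by (intro mult_nonneg_nonneg add_nonneg_nonneg) auto
    finally show "3 * t\<^sup>2 - 2 * t ^ 3 \<le> 7 / 27" by simp
  qed
  have False_case: "p \<le> 1 / 3" if "\<not> b"
  proof -
    have "output_prob P x y (\<not> b) \<le> 1 / 3"
      using assms(2,3) unfolding computes_def by blast
    then show ?thesis using that by (simp add: p_def)
  qed
  have True_case: "1 - p \<le> 1 / 3" if b
  proof -
    have "output_prob P x y (\<not> b) \<le> 1 / 3"
      using assms(2,3) unfolding computes_def by blast
    then show ?thesis using that output_prob_sum[OF assms(1), of x y] by (simp add: p_def)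
  qed
  show "b = (p > 1 / 2)" using False_case True_case by (cases b) auto
  \<comment> \<open>The symmetry under exchanging \<open>p\<close> and \<open>1 - p\<close> reduces
    the case of output \<open>True\<close> to the other one.\<close>
  have "1 - (3 * p\<^sup>2 - 2 * p ^ 3) = 3 * (1 - p)\<^sup>2 - 2 * (1 - p) ^ 3"
    by (simp add: power2_eq_square power3_eq_cube algebra_simps)
  then show "\<bar>of_bool b - (3 * p\<^sup>2 - 2 * p ^ 3)\<bar> \<le> 7 / 27"
    using amplify[of p] amplify[of "1 - p"] p False_case True_case by (cases b) auto
qed

text \<open>An average of numbers within \<epsilon> of \<open>f z\<close> stays within \<epsilon>.
  The product weights vanish unless every block \<open>i\<close> has \<open>g\<close>-value
  \<open>z ! i\<close>, so \<open>Q\<close> matters only where the composed function is defined with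
  value \<open>f z\<close>.\<close>

lemma block_distribution_average:
  assumes I: "I \<subseteq> bits k" "J \<subseteq> bits k"
    and \<mu>: "\<And>b. is_b_distribution g I J b (\<mu> b)" and z: "z \<in> bits n"
    and Q: "\<And>x y b. block_compose n k f g (x, y) = Some b \<Longrightarrow> \<bar>of_bool b - Q x y\<bar> \<le> \<epsilon>"
  shows "\<bar>of_bool (f z) - (\<Sum>x\<in>blocks_in k n I. \<Sum>y\<in>blocks_in k n J.
           (\<Prod>i<n. pmf (\<mu> (z ! i)) (block k x i, block k y i)) * Q x y)\<bar> \<le> \<epsilon>"
proof -
  define w where "w x y = (\<Prod>i<n. pmf (\<mu> (z ! i)) (block k x i, block k y i))" for x y
  define X where "X = blocks_in k n I"
  define Y where "Y = blocks_in k n J"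
  have fin: "finite I" "finite J" using I by (blast intro: finite_subset[OF _ finite_bits])+
  have len: "\<forall>a\<in>I. length a = k" "\<forall>b\<in>J. length b = k" using I by (auto simp: bits_def)
  have w0: "0 \<le> w x y" for x y by (simp add: w_def prod_nonneg)
  have "(\<Sum>a\<in>I. \<Sum>b\<in>J. pmf (\<mu> c) (a, b)) = 1" for c
    using \<mu>[of c] by (intro sum_sum_pmf fin) (auto simp: is_b_distribution_def)
  then have w1: "(\<Sum>x\<in>X. \<Sum>y\<in>Y. w x y) = 1"
    unfolding X_def Y_def w_def sum_prod_blocks[OF len, where n = n and h = "\<lambda>i a b. pmf (\<mu> (z ! i)) (a, b)"] by simp
  have "\<bar>w x y * (of_bool (f z) - Q x y)\<bar> \<le> w x y * \<epsilon>" if "x \<in> X" "y \<in> Y" for x y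
  proof (cases "w x y = 0")
    case False
    have g: "g (block k x i, block k y i) = Some (z ! i)" if "i < n" for i
    proof -
      have "pmf (\<mu> (z ! i)) (block k x i, block k y i) \<noteq> 0"
        using False that by (auto simp: w_def)
      then show ?thesis
        using \<mu>[of "z ! i"] by (auto simp: is_b_distribution_def set_pmf_iff)
    qed
    have "map (\<lambda>i. the (g (block k x i, block k y i))) [0..<n] = z"
      using g z by (simp add: bits_def list_eq_iff_nth_eq)
    then have "block_compose n k f g (x, y) = Some (f z)"
      using \<open>x \<in> X\<close> \<open>y \<in> Y\<close> g by (auto simp: block_compose_def bits_def X_def Y_def blocks_in_def dom_def)
    from Q[OF this] show ?thesis using w0 by (simp add: abs_mult mult_left_mono)
  qed simp
  then have "\<bar>\<Sum>x\<in>X. \<Sum>y\<in>Y. w x y * (of_bool (f z) - Q x y)\<bar> \<le> (\<Sum>x\<in>X. \<Sum>y\<in>Y. w x y * \<epsilon>)"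
    by (intro order_trans[OF sum_abs] sum_mono)
  also have "(\<Sum>x\<in>X. \<Sum>y\<in>Y. w x y * \<epsilon>) = \<epsilon>"
    using w1 by (simp add: sum_distrib_right[symmetric])
  also have "(\<Sum>x\<in>X. \<Sum>y\<in>Y. w x y * (of_bool (f z) - Q x y))
      = (\<Sum>x\<in>X. \<Sum>y\<in>Y. w x y) * of_bool (f z) - (\<Sum>x\<in>X. \<Sum>y\<in>Y. w x y * Q x y)"
    by (simp add: sum_subtractf sum_distrib_right right_diff_distrib)
  finally show ?thesis by (simp only: w1 mult_1) (simp only: w_def X_def Y_def)
qed

text \<open>Unless \<open>(4/3) ^ D < 378 * 64 ^ q\<close>, truncation would produce a degree
  smaller than \<open>D\<close>, the degree itself. With \<open>q \<ge> 1\<close> that inequality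
  bounds \<open>D\<close> linearly in \<open>q\<close>.\<close>

lemma protocol_length_ge:
  assumes n: "n \<ge> 1" and dom: "dom g \<subseteq> bits k \<times> bits k"
    and witness: "spectral_discrepancy_witness k g r" and r: "r < real (approx_degree n f) / (5 * real n)"
    and P: "valid_qprotocol P" "computes P (block_compose n k f g)"
  shows "approx_degree n f \<le> 54 * length (messages P)"
proof (cases "approx_degree n f = 0")
  case False
  define D where "D = approx_degree n f"
  have D: "D \<ge> 1" using False by (simp add: D_def)
  obtain I J \<mu>\<^sub>0 \<mu>\<^sub>1 where I: "I \<subseteq> bits k" "J \<subseteq> bits k"
    and \<mu>: "is_b_distribution g I J False \<mu>\<^sub>0" "is_b_distribution g I J True \<mu>\<^sub>1"
    and norm_plus: "sqrt (real (card I) * real (card J)) *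
          spectral_norm I J (\<lambda>a b. (pmf \<mu>\<^sub>0 (a, b) + pmf \<mu>\<^sub>1 (a, b)) / 2) \<le> 1 + r"
    and norm_minus: "sqrt (real (card I) * real (card J)) *
          spectral_norm I J (\<lambda>a b. (pmf \<mu>\<^sub>0 (a, b) - pmf \<mu>\<^sub>1 (a, b)) / 2) \<le> r"
    using witness unfolding spectral_discrepancy_witness_def by blast
  have fin: "finite I" "finite J" using I by (blast intro: finite_subset[OF _ finite_bits])+
  have len: "\<forall>a\<in>I. length a = k" "\<forall>b\<in>J. length b = k" using I by (auto simp: bits_def)
  define s where "s = sqrt (real (card I) * real (card J))"
  have s: "s > 0"
    using sqrt_card_pos[OF I, of \<mu>\<^sub>0] \<mu>(1) by (auto simp: s_def is_b_distribution_def)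
  have plus: "op_bounded I J (\<lambda>a b. (pmf \<mu>\<^sub>0 (a, b) + pmf \<mu>\<^sub>1 (a, b)) / 2) ((1 + r) / s)"
    and minus: "op_bounded I J (\<lambda>a b. (pmf \<mu>\<^sub>0 (a, b) - pmf \<mu>\<^sub>1 (a, b)) / 2) (r / s)"
    using norm_plus norm_minus s unfolding s_def[symmetric]
    by (auto intro!: op_bounded_spectral_norm fin simp: pos_le_divide_eq mult.commute)
  have r0: "0 \<le> r" using minus s by (auto simp: op_bounded_def zero_le_divide_iff)
  have rn: "5 * r * real n \<le> real D" using r n by (simp add: D_def field_simps)
  have "D \<le> n" unfolding D_def by (rule approx_degree_le_arity)
  then have "real D / (5 * real n) \<le> 1" using n by simp
  then have r1: "r < 1" using r by (simp add: D_def)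
  define p where "p x y = output_prob P x y True" for x y
  define q where "q = length (messages P)"
  have q: "q \<ge> 1"
  proof (rule ccontr)
    assume "\<not> q \<ge> 1"
    then have msgs: "messages P = []" by (simp add: q_def Suc_le_eq)
    have "approx_degree n f = 0"
    proof (rule approx_degree_eq_0_if_one_sided[OF n dom I s_def s \<mu> minus r1])
      show "(\<forall>x y b. block_compose n k f g (x, y) = Some b \<longrightarrow> b = (case final_action P of
                Alice U i \<Rightarrow> p x undefined > 1 / 2 | Bob U i \<Rightarrow> p undefined x > 1 / 2)) \<or>
            (\<forall>x y b. block_compose n k f g (x, y) = Some b \<longrightarrow> b = (case final_action P of
                Alice U i \<Rightarrow> p y undefined > 1 / 2 | Bob U i \<Rightarrow> p undefined y > 1 / 2))"
      \<comment> \<open>Without messages only the player of the final action transforms the state,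
        so the acceptance probability ignores the other input; \<open>undefined\<close> fills its
        place.\<close>
      proof (cases "final_action P")
        case (Alice U i)
        then have "p x y = p x undefined" for x y
          by (simp add: p_def output_prob_def msgs)
        then show ?thesis
          using computes_acceptance(1)[OF P] Alice unfolding p_def by (metis action.simps(5))
      next
        case (Bob U i)
        then have "p x y = p undefined y" for x y
          by (simp add: p_def output_prob_def msgs)
        then show ?thesis
          using computes_acceptance(1)[OF P] Bob unfolding p_def by (metis action.simps(6))
      qed
    qed
    then show False using False by simp
  qed
  \<comment> \<open>With the bound \<open>2 * 4 ^ q\<close> for \<open>p\<close>, the square
    contributes \<open>12 * 16 ^ q\<close> and the cube \<open>16 * 64 ^ q\<close>; 28 = 12 +
    16.\<close>
  define K :: real where "K = 28 * 64 ^ q"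
  have schur: "schur_bounded X Y (\<lambda>x y. 3 * (p x y)\<^sup>2 - 2 * p x y ^ 3) K" for X Y
  proof -
    have 1: "schur_bounded X Y p (2 * 4 ^ q)"
      unfolding p_def q_def by (rule schur_bounded_output_prob[OF P(1)])
    note 2 = schur_bounded_mult[OF 1 1]
    note 3 = schur_bounded_mult[OF 1 2]
    have "schur_bounded X Y (\<lambda>x y. 3 * (p x y)\<^sup>2 - 2 * p x y ^ 3)
        (3 * (2 * 4 ^ q * (2 * 4 ^ q)) + 2 * (2 * 4 ^ q * (2 * 4 ^ q * (2 * 4 ^ q))))"
      using schur_bounded_add[OF schur_bounded_cmult[OF 2, of 3] schur_bounded_cmult[OF 3, of "-2"]]
      by (simp add: power2_eq_square power3_eq_cube mult.assoc)
    moreover have "3 * (2 * 4 ^ q * (2 * 4 ^ q)) + 2 * (2 * 4 ^ q * (2 * 4 ^ q * (2 * 4 ^ q))) \<le> K"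
    proof -
      have "(4::real) ^ q * 4 ^ q = 16 ^ q" "(16::real) ^ q * 4 ^ q = 64 ^ q"
        by (simp_all add: power_mult_distrib[symmetric])
      moreover have "(16::real) ^ q \<le> 64 ^ q" by (rule power_mono) auto
      ultimately show ?thesis by (simp add: K_def mult_ac)
    qed
    ultimately show ?thesis by (rule schur_bounded_mono)
  qed
  \<comment> \<open>378 is 28 * 27 / 2: if the inequality fails, \<open>K * (3/4) ^ D\<close> is at
    most 2/27, the gap between 7/27 and 1/3.\<close>
  have "(4/3::real) ^ D < 378 * 64 ^ q"
  proof (rule ccontr)
    assume large: "\<not> ?thesis"
    have "(1 + 5 * r) ^ n \<le> exp (5 * r) ^ n"
      using r0 by (intro power_mono) auto
    also have "\<dots> \<le> exp (real D)"
      using rn by (simp add: exp_of_nat_mult[symmetric] mult_ac)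
    also have "\<dots> \<le> 3 ^ D"
      using exp_le by (simp add: exp_of_nat_mult[of D 1, simplified] power_mono)
    finally have "(1 + 5 * r) ^ n / 4 ^ D \<le> (3/4) ^ D"
      by (simp add: power_divide divide_right_mono)
    also have "(3/4::real) ^ D = 1 / (4/3) ^ D"
      by (simp add: power_divide)
    also have "\<dots> \<le> 1 / (378 * 64 ^ q)"
      using large by (intro divide_left_mono) auto
    finally have tail: "7/27 + K * ((1 + 5 * r) ^ n / 4 ^ D) \<le> 1/3"
      by (simp add: K_def field_simps)
    have "approx_degree n f < D"
    proof (rule approx_degree_less[OF len s_def s, where m = "\<lambda>c a b. pmf (if c then \<mu>\<^sub>1 else \<mu>\<^sub>0) (a, b)"])
      show "\<bar>of_bool (f z) - (\<Sum>x\<in>blocks_in k n I. \<Sum>y\<in>blocks_in k n J.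
          (\<Prod>i<n. pmf (if z ! i then \<mu>\<^sub>1 else \<mu>\<^sub>0) (block k x i, block k y i)) *
          (3 * (p x y)\<^sup>2 - 2 * p x y ^ 3))\<bar> \<le> 7 / 27" if "z \<in> bits n" for z
        unfolding p_def
        by (intro block_distribution_average[OF I, where \<mu> = "\<lambda>c. if c then \<mu>\<^sub>1 else \<mu>\<^sub>0"]
            computes_acceptance(2)[OF P] that) (use \<mu> in \<open>auto split: if_split\<close>)
    qed (use plus minus schur tail D in auto)
    then show False by (simp add: D_def)
  qed
  \<comment> \<open>Here \<open>q \<ge> 1\<close> absorbs the constant, as 378 is below the square
    of 64.\<close>
  also have "378 * 64 ^ q \<le> ((64::real) ^ q) ^ 3"
  proof -
    have "(64::real) ^ 1 \<le> 64 ^ q" using q by (intro power_increasing) auto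
    then have "64 * 64 \<le> ((64::real) ^ q) * 64 ^ q" by (intro mult_mono) auto
    then have "378 * 64 ^ q \<le> ((64::real) ^ q * 64 ^ q) * 64 ^ q" by (intro mult_right_mono) auto
    then show ?thesis by (simp add: power3_eq_cube)
  qed
  also have "\<dots> = (64::real) ^ (3 * q)" by (simp add: power_mult[symmetric] mult.commute)
  \<comment> \<open>\<open>(4/3) ^ 18\<close> is about 177 and exceeds 64; 54 = 3 * 18.\<close>
  also have "\<dots> \<le> ((4/3) ^ 18) ^ (3 * q)" by (intro power_mono) (auto simp: power_divide field_simps)
  also have "\<dots> = (4/3) ^ (54 * q)" by (simp add: power_mult[symmetric])
  finally have "D < 54 * q" by (subst (asm) power_strict_increasing_iff) auto
  then show ?thesis by (simp add: D_def q_def)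
qed simp

theorem lemma3p5:
  shows "\<exists>c::real. c > 0 \<and>
    (\<forall>(n::nat) (k::nat) (g :: bool list \<times> bool list \<rightharpoonup> bool) (f :: bool list \<Rightarrow> bool).
       n \<ge> 1 \<longrightarrow> k \<ge> 1 \<longrightarrow> dom g \<subseteq> bits k \<times> bits k \<longrightarrow>
       spectral_discrepancy k g \<le> ereal (real (approx_degree n f) / (2 * exp 1 * real n)) \<longrightarrow>
       ereal_of_enat (quantum_cc (block_compose n k f g)) \<ge> ereal (c * real (approx_degree n f)))"
proof (intro exI[of _ "1/54"] conjI allI impI)
  fix n k :: nat and g :: "bool list \<times> bool list \<rightharpoonup> bool" and f :: "bool list \<Rightarrow> bool"
  assume n: "n \<ge> 1" and dom: "dom g \<subseteq> bits k \<times> bits k"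
    and sd: "spectral_discrepancy k g \<le> ereal (real (approx_degree n f) / (2 * exp 1 * real n))"
  define F where "F = block_compose n k f g"
  have length_ge: "approx_degree n f \<le> 54 * length (messages P)" if "valid_qprotocol P" "computes P F"
    for P :: "(bool list, bool list) qprotocol"
  proof (cases "approx_degree n f = 0")
    case False
    \<comment> \<open>13/8 is \<open>1 + t + t^2 / 2\<close> at \<open>t = 1/2\<close>; its square
      169/64 exceeds 5/2.\<close>
    have "exp (1/2::real) \<ge> 13/8"
      using exp_lower_Taylor_quadratic[of "1/2"] by (simp add: power2_eq_square)
    then have "(13/8::real)\<^sup>2 \<le> (exp (1/2))\<^sup>2" by (intro power_mono) auto
    then have "2 * exp (1::real) > 5" by (simp add: power2_eq_square exp_add[symmetric])
    then have "real (approx_degree n f) / (2 * exp 1 * real n) < real (approx_degree n f) / (5 * real n)"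
      using n False by (intro divide_strict_left_mono mult_strict_right_mono) auto
    then have "spectral_discrepancy k g < ereal (real (approx_degree n f) / (5 * real n))"
      using sd by (meson less_ereal.simps(1) order_le_less_trans)
    then obtain r where "spectral_discrepancy_witness k g r" "r < real (approx_degree n f) / (5 * real n)"
      unfolding spectral_discrepancy_def Inf_less_iff by auto
    from protocol_length_ge[OF n dom this that[unfolded F_def]] show ?thesis .
  qed simp
  \<comment> \<open>In \<open>enat\<close> the infimum of a nonempty set is attained; the empty set
    gives infinity, for which the bound is trivial.\<close>
  have "quantum_cc F = \<infinity> \<or> (\<exists>P. valid_qprotocol P \<and> computes P F \<and> quantum_cc F = enat (length (messages P)))"
  proof (cases "{enat (length (messages P)) | P. valid_qprotocol P \<and> computes P F} = {}")
    case True
    then show ?thesis unfolding quantum_cc_def by (simp only: True Inf_enat_def) simp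
  next
    case False
    then have "quantum_cc F \<in> {enat (length (messages P)) | P. valid_qprotocol P \<and> computes P F}"
      unfolding quantum_cc_def Inf_enat_def using LeastI_ex by (smt (verit) ex_in_conv)
    then show ?thesis by blast
  qed
  then show "ereal (1/54 * real (approx_degree n f)) \<le> ereal_of_enat (quantum_cc (block_compose n k f g))"
    using length_ge unfolding F_def[symmetric] by fastforce
qed simp

end
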